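(* Let $d>1$ be a squarefree integer and let $m,n$ be nonzero integers with $m^2-dn^2=-4$. Let $p$ be a prime with $p\nmid n$ and $p=x^2+3dy^2$, where $x,y$ are integers with $3\nmid y$ and $x\equiv y\pmod 3$. Then $$U_{\frac{p-1}{3}}(m,-1)\equiv \begin{cases} 0\pmod p & \text{if } m\equiv 0,\pm4\pmod 9,\\ \big(\frac{mn/3}{3}\big)\frac{x}{dny}\pmod p & \text{if } m\equiv\pm3\pmod 9,\\ -\big(\frac{mn}{3}\big)\frac{x}{dny}\pmod p & \text{if } m\equiv\pm1\pmod 9,\\ \big(\frac{mn}{3}\big)\frac{x}{dny}\pmod p & \text{if } m\equiv\pm2\pmod 9,\end{cases}$$ where $\big(\frac{\cdot}{3}\big)$ is the Legendre symbol.
   Context: $\{U_k(b,c)\}_{k\ge0}$ is the Lucas sequence defined by $U_0=0$, $U_1=1$, $U_{k+1}=bU_k-cU_{k-1}$ for $k\ge1$. The denominator $dny$ is prime to $p$ and is inverted modulo $p$. *)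

theory Defs
  imports "HOL-Number_Theory.Number_Theory" "HOL-Computational_Algebra.Squarefree"
begin

fun lucas_U :: "int \<Rightarrow> int \<Rightarrow> nat \<Rightarrow> int" where
  "lucas_U b c 0 = 0"
| "lucas_U b c (Suc 0) = 1"
| "lucas_U b c (Suc (Suc k)) = b * lucas_U b c (Suc k) - c * lucas_U b c k"

text \<open>
  A fraction \<open>a / b\<close> modulo \<open>p\<close> is written \<open>a * modular_inverse p b\<close>. This is the intended
  residue only if \<open>b\<close> is coprime to \<open>p\<close>, since \<open>modular_inverse\<close> returns \<open>0\<close> otherwise; the
  following lemmas show that this case, and truncation in \<open>(p - 1) div 3\<close>, do not arise
  for primes \<open>p = x\<^sup>2 + 3dy\<^sup>2\<close> as below.
\<close>

lemma coprime_denominator: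
  fixes d n x y :: int and p :: nat
  assumes "d > 1" "prime p" "\<not> int p dvd n" "int p = x^2 + 3 * d * y^2" "\<not> 3 dvd y"
  shows "coprime (d * n * y) (int p)"
proof -
  have y: "y \<noteq> 0" using assms(5) by auto
  have y1: "\<bar>y\<bar> \<ge> 1" using y by simp
  have y2: "y^2 \<ge> \<bar>y\<bar>" using mult_left_mono[of 1 "\<bar>y\<bar>" "\<bar>y\<bar>"] y1
    by (simp add: power2_eq_square flip: abs_mult)
  have "d * 1 \<le> d * y^2" using assms(1) y1 y2 by (intro mult_left_mono) auto
  moreover have "1 * y^2 \<le> d * y^2" using assms(1) by (intro mult_right_mono) auto
  ultimately have "d < int p" "\<bar>y\<bar> < int p"
    using assms(1,4) y1 y2 zero_le_power2[of x] by linarith+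
  hence "\<not> int p dvd d" "\<not> int p dvd y"
    using assms(1) y zdvd_not_zless[of d "int p"] zdvd_not_zless[of "\<bar>y\<bar>" "int p"] by auto
  moreover have P: "prime (int p)" using assms(2) by simp
  ultimately have "\<not> int p dvd d * n * y" using assms(3) by (simp add: prime_dvd_mult_iff)
  thus ?thesis using P by (metis prime_imp_coprime coprime_commute)
qed

lemma three_dvd_p_minus_1:
  fixes d x y :: int and p :: nat
  assumes "int p = x^2 + 3 * d * y^2" "\<not> 3 dvd y" "[x = y] (mod 3)"
  shows "3 dvd p - 1"
proof -
  have "x mod 3 = 1 \<or> x mod 3 = 2" using assms(2,3) unfolding cong_def by presburger
  hence "(x mod 3)^2 mod 3 = 1" by auto
  hence "x^2 mod 3 = 1" by (simp add: power_mod)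
  hence "int p mod 3 = 1" using assms(1) by (simp add: mult.assoc)
  thus ?thesis by presburger
qed

end

theory Submission
  imports Defs "HOL-Computational_Algebra.Polynomial"
begin

text \<open>
  Put \<open>\<epsilon> = (m + n \<surd>d) / 2\<close>, of norm \<open>-1\<close>. Since \<open>\<surd>d \<equiv> x / (y \<surd>-3)\<close> modulo \<open>p\<close>, the number
  \<open>\<epsilon>\<close> is congruent to \<open>\<beta> / (2 y \<surd>-3)\<close> with \<open>\<beta> = n x + m y \<surd>-3\<close> in \<open>\<int>[\<omega>]\<close>, so the value of
  \<open>U\<close> at \<open>(p - 1) / 3\<close> is determined by the cubic residue symbol of \<open>\<beta>\<close> modulo the rational
  prime \<open>p\<close>. By cubic reciprocity in Eisenstein's form (one of the two arguments rational) the
  symbol equals that of \<open>p\<close> modulo a primary associate of \<open>\<beta>\<close>; as \<open>\<beta>\<close> has norm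
  \<open>n\<^sup>2 p - 12 y\<^sup>2\<close>, one may replace \<open>n\<^sup>2 p\<close> by \<open>12 y\<^sup>2\<close> there. Reciprocity applied backwards
  disposes of the factors of \<open>n\<close> and \<open>2 y\<close>, and the supplementary law for \<open>3\<close> yields the
  dependence on \<open>m\<close> modulo \<open>9\<close>.

  Reciprocity itself is proved with the cubic Gauss sum modulo a prime \<open>q \<equiv> 1 (mod 3)\<close>, taken in
  \<open>\<int>[\<omega>][X]\<close> modulo \<open>X\<^sup>q - 1\<close>: its \<open>r\<close>-th power is computed once through the Jacobi sum and once
  through the Frobenius map modulo \<open>r\<close>.
\<close>

section \<open>The Eisenstein integers\<close>

text \<open>Reciprocity applies to primary arguments only, and \<beta> is in general neither primary
  nor prime to n and 2 y. Dividing by the gcd of n and 2 y cures the second defect, a factor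
  \<omega>^j the first. This unit causes the case distinction: for 3 dividing m one has j = 0 and
  only the supplementary law contributes; otherwise j is 1 or 2, and symbols of \<omega> enter, with
  exponents of the form (z^2 - 1) / 3. Exponents matter modulo 3 and arise from a division by 3,
  which is why m matters modulo 9.

  The moduli of the symbol are rational primes r, split or inert. A character modulo a primary
  element is assembled by splitting off, guided by the norm, either an inert prime or a Jacobi sum;
  the latter is the explicit generator of a prime above q.

  Residues modulo X^q - 1 have well-defined coefficients, and comparing those at X brings an
  identity of Gauss sums down to Z[\<omega>]. The price is that \<open>gsum triv\<close> stands
  where the integer q would stand in the cyclotomic field.\<close>

datatype eis = Eis (eis_re: int) (eis_om: int)

instantiation eis :: comm_ring_1
begin
definition "0 = Eis 0 0"
definition "1 = Eis 1 0"
definition "u + v = Eis (eis_re u + eis_re v) (eis_om u + eis_om v)"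
definition "u - v = Eis (eis_re u - eis_re v) (eis_om u - eis_om v)"
definition "- u = Eis (- eis_re u) (- eis_om u)"
definition "u * v = Eis (eis_re u * eis_re v - eis_om u * eis_om v)
  (eis_re u * eis_om v + eis_om u * eis_re v - eis_om u * eis_om v)"
instance
  by standard (auto simp: zero_eis_def one_eis_def plus_eis_def minus_eis_def uminus_eis_def
      times_eis_def algebra_simps)
end

lemma eis_simps [simp]:
  "eis_re 0 = 0" "eis_om 0 = 0" "eis_re 1 = 1" "eis_om 1 = 0"
  "eis_re (u + v) = eis_re u + eis_re v" "eis_om (u + v) = eis_om u + eis_om v"
  "eis_re (u - v) = eis_re u - eis_re v" "eis_om (u - v) = eis_om u - eis_om v"
  "eis_re (- u) = - eis_re u" "eis_om (- u) = - eis_om u"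
  "eis_re (u * v) = eis_re u * eis_re v - eis_om u * eis_om v"
  "eis_om (u * v) = eis_re u * eis_om v + eis_om u * eis_re v - eis_om u * eis_om v"
  by (simp_all add: zero_eis_def one_eis_def plus_eis_def minus_eis_def uminus_eis_def times_eis_def)

lemma eis_eq_iff: "u = v \<longleftrightarrow> eis_re u = eis_re v \<and> eis_om u = eis_om v"
  by (cases u; cases v) auto

lemma eis_of_nat [simp]: "eis_re (of_nat n) = int n" "eis_om (of_nat n) = 0"
  by (induction n) auto

lemma eis_of_int [simp]: "eis_re (of_int n) = n" "eis_om (of_int n) = 0"
  by (cases n rule: int_cases2; simp)+

lemma eis_numeral [simp]: "eis_re (numeral n) = numeral n" "eis_om (numeral n) = 0"
  using eis_of_nat[of "numeral n"] by simp_all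

definition omega :: eis where "omega = Eis 0 1"

lemma eis_omega [simp]: "eis_re omega = 0" "eis_om omega = 1"
  by (simp_all add: omega_def)

definition eis_cnj :: "eis \<Rightarrow> eis" where
  "eis_cnj u = Eis (eis_re u - eis_om u) (- eis_om u)"

lemma eis_cnj_simps [simp]:
  "eis_re (eis_cnj u) = eis_re u - eis_om u" "eis_om (eis_cnj u) = - eis_om u"
  "eis_cnj 0 = 0" "eis_cnj 1 = 1" "eis_cnj (eis_cnj u) = u"
  "eis_cnj (u + v) = eis_cnj u + eis_cnj v" "eis_cnj (u - v) = eis_cnj u - eis_cnj v"
  "eis_cnj (u * v) = eis_cnj u * eis_cnj v" "eis_cnj (- u) = - eis_cnj u"
  "eis_cnj (of_int n) = of_int n" "eis_cnj (of_nat m) = of_nat m"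
  by (auto simp: eis_cnj_def eis_eq_iff algebra_simps)

lemma eis_cnj_power [simp]: "eis_cnj (u ^ n) = eis_cnj u ^ n"
  by (induction n) auto

lemma eis_cnj_sum: "eis_cnj (sum f S) = (\<Sum>i\<in>S. eis_cnj (f i))"
  by (induction S rule: infinite_finite_induct) auto

definition eis_norm :: "eis \<Rightarrow> int" where
  "eis_norm u = eis_re u ^ 2 - eis_re u * eis_om u + eis_om u ^ 2"

lemma eis_mult_cnj: "u * eis_cnj u = of_int (eis_norm u)"
  by (simp add: eis_eq_iff eis_norm_def power2_eq_square algebra_simps)

lemma eis_norm_mult: "eis_norm (u * v) = eis_norm u * eis_norm v"
  by (simp add: eis_norm_def power2_eq_square algebra_simps)

lemma four_eis_norm: "4 * eis_norm u = (2 * eis_re u - eis_om u) ^ 2 + 3 * eis_om u ^ 2"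
  by (simp add: eis_norm_def power2_eq_square algebra_simps)

lemma eis_norm_nonneg: "eis_norm u \<ge> 0"
  using four_eis_norm[of u] zero_le_power2[of "2 * eis_re u - eis_om u"]
    zero_le_power2[of "eis_om u"] by linarith

lemma eis_norm_eq_0_iff [simp]: "eis_norm u = 0 \<longleftrightarrow> u = 0"
proof
  assume "eis_norm u = 0"
  hence "(2 * eis_re u - eis_om u) ^ 2 + 3 * eis_om u ^ 2 = 0"
    using four_eis_norm[of u] by simp
  hence "(2 * eis_re u - eis_om u) ^ 2 = 0 \<and> 3 * eis_om u ^ 2 = 0"
    by (subst (asm) add_nonneg_eq_0_iff) auto
  thus "u = 0" by (simp add: eis_eq_iff)
qed (simp add: eis_norm_def)

lemma eis_norm_simps [simp]: "eis_norm (of_int n) = n ^ 2" "eis_norm (of_nat m) = int m ^ 2"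
  "eis_norm (eis_cnj u) = eis_norm u"
  by (simp_all add: eis_norm_def power2_eq_square algebra_simps)

instance eis :: idom
proof
  fix u v :: eis
  assume "u \<noteq> 0" "v \<noteq> 0"
  hence "eis_norm (u * v) \<noteq> 0" by (simp add: eis_norm_mult)
  thus "u * v \<noteq> 0" by force
qed

instance eis :: ring_char_0
  by standard (auto simp: inj_def eis_eq_iff)

lemma eis_of_int_dvd_iff: "of_int n dvd u \<longleftrightarrow> n dvd eis_re u \<and> n dvd eis_om u"
proof
  assume "n dvd eis_re u \<and> n dvd eis_om u"
  then obtain a b where "eis_re u = n * a" "eis_om u = n * b" by (auto elim!: dvdE)
  hence "u = of_int n * Eis a b" by (simp add: eis_eq_iff)
  thus "of_int n dvd u" by simp
qed (auto elim!: dvdE)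

lemma eis_of_nat_dvd_iff: "of_nat n dvd u \<longleftrightarrow> int n dvd eis_re u \<and> int n dvd eis_om u"
  using eis_of_int_dvd_iff[of "int n"] by simp

lemma eis_dvd_of_int_cancel:
  assumes "prime p" "\<not> int p dvd z" "of_nat p dvd of_int z * u"
  shows "of_nat p dvd (u :: eis)"
  using assms by (auto simp: eis_of_nat_dvd_iff prime_dvd_mult_iff)

text \<open>Integer exponents turn every later comparison of cube roots of unity into a congruence
  modulo 3.\<close>

definition om :: "int \<Rightarrow> eis" where "om e = omega ^ nat (e mod 3)"

lemma omega_square: "omega ^ 2 = -1 - omega"
  by (simp add: eis_eq_iff power2_eq_square)

lemma om_cases: "e mod 3 = 0 \<and> om e = 1 \<or> e mod 3 = 1 \<and> om e = omega
    \<or> e mod 3 = 2 \<and> om e = -1 - omega"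
proof -
  have "e mod 3 = 0 \<or> e mod 3 = 1 \<or> e mod 3 = 2" by presburger
  thus ?thesis by (auto simp: om_def omega_square)
qed

lemma om_eq_iff: "om e = om f \<longleftrightarrow> [e = f] (mod 3)"
  using om_cases[of e] om_cases[of f] by (auto simp: cong_def eis_eq_iff)

lemma om_cong: "[e = f] (mod 3) \<Longrightarrow> om e = om f"
  by (simp add: om_eq_iff)

lemma om_add: "om (e + f) = om e * om f"
proof -
  have "(e + f) mod 3 = (e mod 3 + f mod 3) mod 3" by presburger
  thus ?thesis using om_cases[of e] om_cases[of f] om_cases[of "e + f"]
    by (auto simp: eis_eq_iff)
qed

lemma om_0 [simp]: "om 0 = 1" and om_1 [simp]: "om 1 = omega"
  by (simp_all add: om_def)

lemma om_power: "om e ^ n = om (e * int n)"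
  by (induction n) (auto simp: algebra_simps om_add)

lemma omega_power: "omega ^ n = om (int n)"
  using om_power[of 1 n] by simp

lemma om_cnj: "eis_cnj (om e) = om (2 * e)"
  using om_cases[of e] om_add[of e e] by (auto simp: eis_eq_iff)

lemma om_cube [simp]: "om e ^ 3 = 1"
  using om_eq_iff[of "e * 3" 0] by (simp add: om_power cong_def)

lemma om_mult_cnj: "om e * eis_cnj (om e) = 1"
  using om_eq_iff[of "3 * e" 0] by (simp add: om_cnj cong_def flip: om_add)

lemma om_not_0 [simp]: "om e \<noteq> 0"
  using om_cases[of e] by (auto simp: eis_eq_iff)

text \<open>Distinct cube roots of unity differ by an element of norm 3, and the norm r^2 of a
  rational prime does not divide 3.\<close>

lemma om_dvd_diff_imp_eq:
  assumes "prime r" "of_nat r dvd om e - om f" shows "om e = om f"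
  using om_cases[of e] om_cases[of f] assms prime_gt_1_nat[OF assms(1)]
  by (auto simp: eis_of_nat_dvd_iff)

section \<open>Congruences in commutative rings, Frobenius maps and sums over residues\<close>

definition dcong :: "'a::comm_ring_1 \<Rightarrow> 'a \<Rightarrow> 'a \<Rightarrow> bool" where
  "dcong D a b \<longleftrightarrow> D dvd a - b"

lemma dcong_refl [simp]: "dcong D a a"
  by (simp add: dcong_def)

lemma dcong_sym: "dcong D a b \<Longrightarrow> dcong D b a"
  unfolding dcong_def by (subst dvd_minus_iff [symmetric]) simp

lemma dcong_trans [trans]: "dcong D a b \<Longrightarrow> dcong D b c \<Longrightarrow> dcong D a c"
  unfolding dcong_def using dvd_add[of D "a - b" "b - c"] by simp

lemma dcong_add: "dcong D a b \<Longrightarrow> dcong D a' b' \<Longrightarrow> dcong D (a + a') (b + b')"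
  unfolding dcong_def using dvd_add[of D "a - b" "a' - b'"] by (simp add: algebra_simps)

lemma dcong_mult:
  assumes "dcong D a b" "dcong D a' b'" shows "dcong D (a * a') (b * b')"
proof -
  have "a * a' - b * b' = (a - b) * a' + b * (a' - b')" by (simp add: algebra_simps)
  thus ?thesis using assms unfolding dcong_def by (metis dvd_add dvd_mult dvd_mult2)
qed

lemma dcong_minus: "dcong D a b \<Longrightarrow> dcong D (- a) (- b)"
  using dcong_mult[of D "-1" "-1" a b] by simp

lemma dcong_diff: "dcong D a b \<Longrightarrow> dcong D a' b' \<Longrightarrow> dcong D (a - a') (b - b')"
  using dcong_add[of D a b "- a'" "- b'"] dcong_minus[of D a' b'] by simp

lemma dcong_power: "dcong D a b \<Longrightarrow> dcong D (a ^ n) (b ^ n)"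
  by (induction n) (auto intro: dcong_mult)

lemma dcong_sum: "(\<And>i. i \<in> S \<Longrightarrow> dcong D (f i) (g i)) \<Longrightarrow> dcong D (sum f S) (sum g S)"
  by (induction S rule: infinite_finite_induct) (auto intro: dcong_add)

lemma dcong_power_add_prime:
  fixes a b :: "'a :: comm_ring_1"
  assumes "prime r"
  shows "dcong (of_nat r) ((a + b) ^ r) (a ^ r + b ^ r)"
proof -
  have r: "r > 0" using assms prime_gt_0_nat by blast
  have "(a + b) ^ r = (\<Sum>k\<in>{..r}. of_nat (r choose k) * a ^ k * b ^ (r - k))"
    by (simp add: binomial_ring)
  also have "{..r} = insert 0 (insert r {1..<r})" using r by auto
  also have "(\<Sum>k\<in>\<dots>. of_nat (r choose k) * a ^ k * b ^ (r - k))
      = b ^ r + a ^ r + (\<Sum>k\<in>{1..<r}. of_nat (r choose k) * a ^ k * b ^ (r - k))"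
    using r by (subst sum.insert) (auto simp: add_ac)
  finally have "(a + b) ^ r - (a ^ r + b ^ r)
      = (\<Sum>k\<in>{1..<r}. of_nat (r choose k) * a ^ k * b ^ (r - k))" by simp
  moreover have "of_nat r dvd (\<Sum>k\<in>{1..<r}. of_nat (r choose k) * a ^ k * b ^ (r - k))"
  proof (intro dvd_sum dvd_mult2)
    fix k assume "k \<in> {1..<r}"
    hence "r dvd r choose k" using assms r by (intro dvd_choose_prime) auto
    thus "of_nat r dvd (of_nat (r choose k) :: 'a)" by (auto elim!: dvdE)
  qed
  ultimately show ?thesis unfolding dcong_def by metis
qed

lemma dcong_sum_power_prime:
  fixes f :: "'b \<Rightarrow> 'a :: comm_ring_1"
  assumes "prime r" "finite S"
  shows "dcong (of_nat r) (sum f S ^ r) (\<Sum>i\<in>S. f i ^ r)"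
  using assms(2)
proof induction
  case empty
  then show ?case using prime_gt_0_nat[OF assms(1)] by (simp add: zero_power)
next
  case (insert i S)
  have "dcong (of_nat r) ((f i + sum f S) ^ r) (f i ^ r + sum f S ^ r)"
    by (rule dcong_power_add_prime[OF assms(1)])
  also have "dcong (of_nat r) (f i ^ r + sum f S ^ r) (f i ^ r + (\<Sum>i\<in>S. f i ^ r))"
    by (intro dcong_add insert.IH) simp
  finally show ?case using insert.hyps by simp
qed

lemma sum_residues_reindex:
  fixes h :: "int \<Rightarrow> 'a :: comm_monoid_add"
  assumes "q > 0" and per: "\<And>t. h (t mod q) = h t"
    and inj: "\<And>s t. [\<phi> s = \<phi> t] (mod q) \<Longrightarrow> [s = t] (mod q)"
  shows "(\<Sum>t\<in>{0..<q}. h (\<phi> t)) = (\<Sum>t\<in>{0..<q}. h t)"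
proof -
  let ?\<psi> = "\<lambda>t. \<phi> t mod q"
  have i: "inj_on ?\<psi> {0..<q}"
  proof (rule inj_onI)
      fix s t assume "s \<in> {0..<q}" "t \<in> {0..<q}" "?\<psi> s = ?\<psi> t"
      moreover from this have "[s = t] (mod q)" using inj[of s t] by (simp add: cong_def)
      ultimately show "s = t" by (simp add: cong_def)
    qed
  have "?\<psi> ` {0..<q} \<subseteq> {0..<q}" using assms(1) by auto
  hence b: "?\<psi> ` {0..<q} = {0..<q}" by (intro endo_inj_surj i) auto
  have "(\<Sum>t\<in>{0..<q}. h (\<phi> t)) = (\<Sum>t\<in>{0..<q}. h (?\<psi> t))" by (simp add: per)
  also have "\<dots> = (\<Sum>t\<in>?\<psi> ` {0..<q}. h t)" by (simp add: sum.reindex[OF i] o_def)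
  finally show ?thesis by (simp add: b)
qed

lemma sum_residues_mult:
  fixes h :: "int \<Rightarrow> 'a :: comm_monoid_add"
  assumes "q > 0" "\<And>t. h (t mod q) = h t" "coprime u q"
  shows "(\<Sum>t\<in>{0..<q}. h (u * t)) = (\<Sum>t\<in>{0..<q}. h t)"
  using assms by (intro sum_residues_reindex) (auto simp: cong_mult_lcancel)

lemma sum_residues_diff:
  fixes h :: "int \<Rightarrow> 'a :: comm_monoid_add"
  assumes "q > 0" "\<And>t. h (t mod q) = h t"
  shows "(\<Sum>t\<in>{0..<q}. h (t - s)) = (\<Sum>t\<in>{0..<q}. h t)"
  using assms by (intro sum_residues_reindex) (auto simp: cong_iff_dvd_diff)

lemma exists_primitive_power:
  assumes "prime q" "0 < j" "j < q - 1"
  shows "\<exists>g::int. coprime g (int q) \<and> \<not> [g ^ j = 1] (mod int q)"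
proof -
  from assms(1) prime_primitive_root_exists[of q] obtain g where g: "residue_primroot q g"
    using prime_gt_1_nat by blast
  hence o: "coprime q g" "ord q g = q - 1"
    using assms(1) by (auto simp: residue_primroot_def totient_prime)
  have "\<not> [g ^ j = 1] (mod q)"
    using assms o nat_dvd_not_less[of j "q - 1"] by (metis ord_divides)
  hence "\<not> [int g ^ j = 1] (mod int q)"
    using cong_int_iff[of "g ^ j" 1 q] by simp
  thus ?thesis using o by (intro exI[of _ "int g"]) (auto simp: coprime_commute)
qed

text \<open>Scaling the variable by g multiplies the sum by g^j, so a g with g^j different from 1
  modulo q forces it to vanish. For j = 0 the sum is q, because 0^0 = 1.\<close>

lemma prime_dvd_sum_powers:
  assumes "prime q" "j < q - 1"
  shows "int q dvd (\<Sum>t\<in>{0..<int q}. t ^ j)"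
proof (cases "j = 0")
  case False
  then obtain g where g: "coprime g (int q)" "\<not> [g ^ j = 1] (mod int q)"
    using exists_primitive_power assms by blast
  have q: "int q > 0" using assms(1) prime_gt_0_nat by auto
  let ?h = "\<lambda>t. (t ^ j) mod int q"
  have "(\<Sum>t\<in>{0..<int q}. ?h (g * t)) = (\<Sum>t\<in>{0..<int q}. ?h t)"
    using q g(1) by (intro sum_residues_mult) (auto simp: power_mod)
  hence "[(\<Sum>t\<in>{0..<int q}. (g * t) ^ j) = (\<Sum>t\<in>{0..<int q}. t ^ j)] (mod int q)"
    unfolding cong_def by (metis mod_sum_eq)
  hence "int q dvd (g ^ j - 1) * (\<Sum>t\<in>{0..<int q}. t ^ j)"
    by (simp add: cong_iff_dvd_diff power_mult_distrib algebra_simps sum_distrib_left sum_subtractf)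
  moreover have "\<not> int q dvd g ^ j - 1" using g(2) by (simp add: cong_iff_dvd_diff)
  moreover have "prime (int q)" using assms(1) by simp
  ultimately show ?thesis using prime_dvd_mult_iff by blast
qed simp

section \<open>Cubic characters and their Gauss sums\<close>

text \<open>Choosing \<open>c\<close> means choosing one of the two primes of Z[\<omega>] above
  \<open>q\<close>: the kernel of the reduction that sends \<omega> to \<open>c\<close>.\<close>

locale cubic_prime =
  fixes q k :: nat and c :: int
  assumes q: "prime q" and qk: "q = 3 * k + 1" and c: "int q dvd c\<^sup>2 + c + 1"
begin

declare q [simp]

lemma q_int: "prime (int q)" using q by simp

lemma q_pos: "q > 1" using q prime_gt_1_nat by blast

lemma k_pos: "k > 0" using q qk by (cases k) auto

lemma not_dvd_3: "\<not> int q dvd 3"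
proof
  assume "int q dvd 3"
  hence "q dvd 3" using int_dvd_int_iff[of q 3] by simp
  hence "q = 3" using q primes_dvd_imp_eq[of q 3] by simp
  thus False using qk by presburger
qed

lemma c_cube: "[c ^ 3 = 1] (mod int q)"
proof -
  have "c ^ 3 - 1 = (c - 1) * (c\<^sup>2 + c + 1)"
    by (simp add: power2_eq_square power3_eq_cube algebra_simps)
  thus ?thesis using c by (simp add: cong_iff_dvd_diff)
qed

lemma c_not_1: "\<not> [c = 1] (mod int q)"
proof
  assume "[c = 1] (mod int q)"
  hence "[c\<^sup>2 + c + 1 = 1\<^sup>2 + 1 + 1] (mod int q)" by (intro cong_add cong_pow) auto
  thus False using c not_dvd_3 by (simp add: cong_dvd_iff)
qed

lemma c_square_not_1: "\<not> [c\<^sup>2 = 1] (mod int q)"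
proof
  assume a: "[c\<^sup>2 = 1] (mod int q)"
  have "[c\<^sup>2 * c = 1 * c] (mod int q)" by (intro cong_mult a) auto
  hence "[c ^ 3 = c] (mod int q)" by (simp add: power2_eq_square power3_eq_cube)
  hence "[c = 1] (mod int q)" using c_cube by (simp add: cong_def)
  thus False using c_not_1 by simp
qed

lemma c_power_mod: "[c ^ i = c ^ (i mod 3)] (mod int q)"
proof -
  have "c ^ i = (c ^ 3) ^ (i div 3) * c ^ (i mod 3)"
    by (metis div_mult_mod_eq mult.commute power_add power_mult)
  moreover have "[(c ^ 3) ^ (i div 3) * c ^ (i mod 3) = 1 ^ (i div 3) * c ^ (i mod 3)] (mod int q)"
    by (intro cong_mult cong_pow c_cube) auto
  ultimately show ?thesis by simp
qed

lemma c_coprime: "coprime c (int q)"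
proof -
  have "coprime (c ^ 3) (int q)" using cong_imp_coprime[OF cong_sym[OF c_cube]] by simp
  thus ?thesis by simp
qed

lemma c_power_eq_iff: "[c ^ i = c ^ j] (mod int q) \<longleftrightarrow> [i = j] (mod 3)"
proof
  assume "[i = j] (mod 3)"
  thus "[c ^ i = c ^ j] (mod int q)"
    using c_power_mod[of i] c_power_mod[of j] by (simp add: cong_def)
next
  have *: "[e = 0] (mod 3)" if "[c ^ (b + e) = c ^ b] (mod int q)" for b e :: nat
  proof -
    have "[c ^ b * c ^ e = c ^ b * 1] (mod int q)"
      using that by (simp add: power_add)
    hence "[c ^ e = 1] (mod int q)" using c_coprime cong_mult_lcancel[of "c ^ b" "int q" "c ^ e" 1]
      by simp
    hence "[c ^ (e mod 3) = 1] (mod int q)"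
      using c_power_mod[of e] by (simp add: cong_def)
    moreover have "e mod 3 = 0 \<or> e mod 3 = 1 \<or> e mod 3 = 2" by presburger
    ultimately have "e mod 3 = 0" using c_not_1 c_square_not_1 by fastforce
    thus ?thesis by (simp add: cong_def)
  qed
  assume a: "[c ^ i = c ^ j] (mod int q)"
  show "[i = j] (mod 3)"
  proof (cases "i \<ge> j")
    case True
    then obtain e where "i = j + e" using le_Suc_ex by blast
    thus ?thesis using *[of j e] a by (simp add: cong_add_lcancel_0_nat)
  next
    case False
    then obtain e where "j = i + e" using le_Suc_ex[of i j] by auto
    hence "[j = i] (mod 3)" using *[of i e] cong_sym[OF a] by (simp add: cong_add_lcancel_0_nat)
    thus ?thesis by (rule cong_sym)
  qed
qed

lemma power_k_cases:
  assumes "\<not> int q dvd t" shows "\<exists>i. [t ^ k = c ^ i] (mod int q)"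
proof -
  have "\<not> q dvd nat (t mod int q)"
    using assms q_pos by (simp add: dvd_mod_iff flip: int_dvd_int_iff)
  from fermat_theorem[OF q this] have "[int (nat (t mod int q)) ^ (q - 1) = 1] (mod int q)"
    using cong_int_iff[of "nat (t mod int q) ^ (q - 1)" 1 q] by simp
  hence "[(t mod int q) ^ (q - 1) = 1] (mod int q)" using q_pos by simp
  hence "[t ^ (q - 1) = 1] (mod int q)" by (simp add: cong_def power_mod)
  hence "int q dvd (t ^ k) ^ 3 - 1"
    using qk by (simp add: cong_iff_dvd_diff mult.commute flip: power_mult)
  \<comment> \<open>Modulo q the last term vanishes, so z^3 - 1 splits into linear factors with
    roots 1, c and c^2.\<close>
  moreover have "(z - 1) * ((z - c) * (z - c\<^sup>2)) =
      z ^ 3 - 1 + (c\<^sup>2 + c + 1) * ((z - 1) * (c - 1 - z))" for z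
    by (simp add: algebra_simps power2_eq_square power3_eq_cube)
  ultimately have "int q dvd (t ^ k - 1) * ((t ^ k - c) * (t ^ k - c\<^sup>2))"
    using c by simp
  hence "int q dvd t ^ k - 1 \<or> int q dvd t ^ k - c \<or> int q dvd t ^ k - c\<^sup>2"
    by (simp add: prime_dvd_mult_iff)
  hence "[t ^ k = c ^ 0] (mod int q) \<or> [t ^ k = c ^ 1] (mod int q) \<or> [t ^ k = c ^ 2] (mod int q)"
    by (simp add: cong_iff_dvd_diff)
  thus ?thesis by blast
qed

text \<open>The cubic residue symbol: t^k is a cube root of unity modulo q, lifted to Z[\<omega>]
  along c to \<omega>. The exponent picked by \<open>SOME\<close> matters only modulo 3.\<close>

definition chi :: "int \<Rightarrow> eis" where
  "chi t = (if int q dvd t then 0 else omega ^ (SOME i. [t ^ k = c ^ i] (mod int q)))"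

lemma chi_eqI:
  assumes "\<not> int q dvd t" "[t ^ k = c ^ i] (mod int q)" shows "chi t = omega ^ i"
proof -
  define j where "j = (SOME i. [t ^ k = c ^ i] (mod int q))"
  have "[t ^ k = c ^ j] (mod int q)" unfolding j_def by (rule someI) fact
  hence "[i = j] (mod 3)" using assms(2) c_power_eq_iff[of i j] by (simp add: cong_def)
  hence "[int i = int j] (mod 3)" using cong_int_iff[of i j 3] by simp
  thus ?thesis using assms(1) by (simp add: chi_def omega_power om_eq_iff cong_sym flip: j_def)
qed

lemma chi_0 [simp]: "int q dvd t \<Longrightarrow> chi t = 0"
  by (simp add: chi_def)

lemma chi_obtain:
  assumes "\<not> int q dvd t"
  obtains i where "[t ^ k = c ^ i] (mod int q)" "chi t = omega ^ i"
  using power_k_cases[OF assms] chi_eqI[OF assms] by blast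

lemma chi_cong: "[s = t] (mod int q) \<Longrightarrow> chi s = chi t"
proof -
  assume a: "[s = t] (mod int q)"
  have "[s ^ k = t ^ k] (mod int q)" using a by (rule cong_pow)
  hence "[s ^ k = c ^ i] (mod int q) \<longleftrightarrow> [t ^ k = c ^ i] (mod int q)" for i by (simp add: cong_def)
  thus "chi s = chi t" using cong_dvd_iff[OF a] by (simp add: chi_def cong_dvd_iff)
qed

lemma chi_mod [simp]: "chi (t mod int q) = chi t"
  by (rule chi_cong) (simp add: cong_def)

lemma chi_mult: "chi (s * t) = chi s * chi t"
proof (cases "int q dvd s \<or> int q dvd t")
  case False
  then obtain i j where "[s ^ k = c ^ i] (mod int q)" "chi s = omega ^ i"
    "[t ^ k = c ^ j] (mod int q)" "chi t = omega ^ j" using chi_obtain by metis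
  moreover from this have "[(s * t) ^ k = c ^ (i + j)] (mod int q)"
    by (simp add: power_mult_distrib power_add cong_mult)
  moreover have "\<not> int q dvd s * t" using False by (simp add: prime_dvd_mult_iff)
  ultimately show ?thesis using chi_eqI[of "s * t" "i + j"] by (simp add: power_add)
qed auto

lemma chi_om: "\<not> int q dvd t \<Longrightarrow> \<exists>e. chi t = om e"
  by (erule chi_obtain) (auto simp: omega_power)

lemma chi_1 [simp]: "chi 1 = 1"
  using chi_eqI[of 1 0] q_pos by simp

lemma chi_cube: "\<not> int q dvd t \<Longrightarrow> chi t ^ 3 = 1"
  by (drule chi_om) auto

lemma chi_power: "chi (t ^ n) = chi t ^ n"
  by (induction n) (auto simp: chi_mult)

text \<open>Because -1 is a cube, signs never influence the symbol.\<close>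

lemma chi_minus_1 [simp]: "chi (-1) = 1"
proof -
  have "\<not> int q dvd -1" using q_pos by simp
  hence "chi (-1) ^ 3 = 1" by (rule chi_cube)
  thus ?thesis using chi_power[of "-1" 3] by simp
qed

lemma chi_square: "chi t ^ 2 = eis_cnj (chi t)"
proof (cases "int q dvd t")
  case False
  then obtain e where "chi t = om e" using chi_om by blast
  thus ?thesis by (simp add: om_power om_cnj mult.commute)
qed auto

lemma chi_mult_cnj: "\<not> int q dvd t \<Longrightarrow> chi t * eis_cnj (chi t) = 1"
  by (drule chi_om) (auto simp: om_mult_cnj)

lemma sum_chi: "(\<Sum>t\<in>{0..<int q}. chi t) = 0"
proof -
  obtain g where g: "coprime g (int q)" "\<not> [g ^ k = 1] (mod int q)"
    using exists_primitive_power[OF q k_pos] qk k_pos by auto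
  have ng: "\<not> int q dvd g" using g(1) q_pos coprime_absorb_right[of "int q" g]
    by (auto simp: coprime_commute)
  then obtain i where i: "[g ^ k = c ^ i] (mod int q)" "chi g = omega ^ i" using chi_obtain by blast
  have "chi g \<noteq> 1"
  proof
    assume "chi g = 1"
    hence "[int i = 0] (mod 3)" using i(2) om_eq_iff[of "int i" 0] by (simp add: omega_power)
    hence "[i = 0] (mod 3)" using cong_int_iff[of i 0 3] by simp
    thus False using c_power_eq_iff[of i 0] i g by (simp add: cong_def)
  qed
  have "(\<Sum>t\<in>{0..<int q}. chi (g * t)) = (\<Sum>t\<in>{0..<int q}. chi t)"
    using q_pos g by (intro sum_residues_mult) auto
  hence "(chi g - 1) * (\<Sum>t\<in>{0..<int q}. chi t) = 0"
    by (simp add: chi_mult algebra_simps sum_distrib_left sum_subtractf)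
  thus ?thesis using \<open>chi g \<noteq> 1\<close> by simp
qed

text \<open>Reduction at \<omega> = c undoes the lift in \<open>chi\<close>. Through this the Jacobi
  sum is later located in the prime belonging to c.\<close>

lemma c_eval_chi: "[eis_re (chi t) + eis_om (chi t) * c = t ^ k] (mod int q)"
proof (cases "int q dvd t")
  case True
  hence "[t ^ k = 0] (mod int q)" using k_pos by (simp add: cong_0_iff dvd_trans[OF _ dvd_power])
  thus ?thesis using True by (simp add: cong_def)
next
  case False
  then obtain i where i: "[t ^ k = c ^ i] (mod int q)" "chi t = omega ^ i" using chi_obtain by blast
  have "[eis_re (omega ^ i) + eis_om (omega ^ i) * c = c ^ i] (mod int q)"
  proof (induction i)
    case (Suc i)
    let ?a = "eis_re (omega ^ i)" and ?b = "eis_om (omega ^ i)"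
    have "[c * (?a + ?b * c) - ?b * (c\<^sup>2 + c + 1) = c * c ^ i - 0] (mod int q)"
      using c by (intro cong_diff cong_mult Suc.IH) (auto simp: cong_0_iff)
    moreover have "c * (?a + ?b * c) - ?b * (c\<^sup>2 + c + 1) = - ?b + (?a - ?b) * c"
      by (simp add: algebra_simps power2_eq_square)
    ultimately show ?case by simp
  qed auto
  thus ?thesis using i by (simp add: cong_def)
qed

end

section \<open>Gauss sums as polynomials modulo X^q - 1 and their convolutions\<close>

lemma poly_of_nat_mult: "of_nat n * (P :: 'a :: comm_ring_1 poly) = smult (of_nat n) P"
  by (simp add: of_nat_poly)

context cubic_prime
begin

definition cyc :: "eis poly" where "cyc = monom 1 q - 1"

definition xpow :: "int \<Rightarrow> eis poly" where "xpow t = monom 1 (nat (t mod int q))"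

definition gsum :: "(int \<Rightarrow> eis) \<Rightarrow> eis poly" where
  "gsum f = (\<Sum>t\<in>{0..<int q}. smult (f t) (xpow t))"

text \<open>The coefficient at X after reduction modulo X^q - 1: a linear functional that kills the
  multiples of \<open>cyc\<close>.\<close>

definition fold1 :: "eis poly \<Rightarrow> eis" where
  "fold1 P = (\<Sum>i\<le>degree P. if i mod q = 1 then coeff P i else 0)"

lemma monom_cyc: "dcong cyc (monom 1 n) (monom 1 (n mod q))"
proof -
  have "monom (1::eis) n = monom 1 q ^ (n div q) * monom 1 (n mod q)"
    by (simp add: monom_power mult_monom)
  also have "dcong cyc \<dots> (1 ^ (n div q) * monom 1 (n mod q))"
    by (intro dcong_mult dcong_power) (auto simp: dcong_def cyc_def)
  finally show ?thesis by simp
qed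

lemma xpow_mult: "dcong cyc (xpow s * xpow t) (xpow (s + t))"
proof -
  have "int ((nat (s mod int q) + nat (t mod int q)) mod q) = (s + t) mod int q"
    using q_pos by (simp add: zmod_int mod_add_eq)
  hence "(nat (s mod int q) + nat (t mod int q)) mod q = nat ((s + t) mod int q)" by linarith
  thus ?thesis using monom_cyc[of "nat (s mod int q) + nat (t mod int q)"]
    by (simp add: xpow_def mult_monom)
qed

lemma xpow_power: "dcong cyc (xpow t ^ n) (xpow (t * int n))"
proof (induction n)
  case 0
  show ?case by (simp add: xpow_def)
next
  case (Suc n)
  have "dcong cyc (xpow t * xpow t ^ n) (xpow t * xpow (t * int n))"
    by (intro dcong_mult Suc.IH) simp
  also have "dcong cyc \<dots> (xpow (t + t * int n))" by (rule xpow_mult)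
  finally show ?case by (simp add: algebra_simps)
qed

lemma xpow_mod [simp]: "xpow (t mod int q) = xpow t"
  by (simp add: xpow_def)

lemma fold1_eq:
  assumes "degree P \<le> n"
  shows "fold1 P = (\<Sum>i\<le>n. if i mod q = 1 then coeff P i else 0)"
  unfolding fold1_def using assms
  by (intro sum.mono_neutral_left) (auto simp: coeff_eq_0)

lemma fold1_add: "fold1 (P + Q) = fold1 P + fold1 Q"
proof -
  define n where "n = max (degree P) (degree Q)"
  have "degree P \<le> n" "degree Q \<le> n" "degree (P + Q) \<le> n"
    by (auto simp: n_def intro: degree_add_le)
  thus ?thesis by (auto simp: fold1_eq simp flip: sum.distrib intro!: sum.cong)
qed

lemma fold1_0 [simp]: "fold1 0 = 0"
  by (simp add: fold1_def)

lemma fold1_smult: "fold1 (smult a P) = a * fold1 P"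
  by (subst fold1_eq[of _ "degree P"])
     (auto simp: fold1_def sum_distrib_left degree_smult_le intro!: sum.cong)

lemma fold1_minus: "fold1 (P - Q) = fold1 P - fold1 Q"
  using fold1_add[of "P - Q" Q] by simp

lemma fold1_sum: "fold1 (sum f S) = (\<Sum>i\<in>S. fold1 (f i))"
  by (induction S rule: infinite_finite_induct) (auto simp: fold1_add)

lemma fold1_monom: "fold1 (monom a n) = (if n mod q = 1 then a else 0)"
proof -
  have "fold1 (monom a n) = (\<Sum>i\<le>n. if i mod q = 1 then coeff (monom a n) i else 0)"
    by (intro fold1_eq degree_monom_le)
  also have "\<dots> = (\<Sum>i\<in>{n}. if i mod q = 1 then coeff (monom a n) i else 0)"
    by (intro sum.mono_neutral_right) auto
  finally show ?thesis by simp
qed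

lemma fold1_cyc_mult: "fold1 (cyc * P) = 0"
proof -
  have "cyc * P = (\<Sum>i\<le>degree P. cyc * monom (coeff P i) i)"
    using arg_cong[OF poly_as_sum_of_monoms[of P], of "\<lambda>x. cyc * x"]
    by (simp add: sum_distrib_left)
  also have "fold1 \<dots> = (\<Sum>i\<le>degree P. fold1 (monom (coeff P i) (q + i)) - fold1 (monom (coeff P i) i))"
    by (simp add: fold1_sum cyc_def algebra_simps mult_monom fold1_minus)
  also have "\<dots> = 0" by (simp add: fold1_monom)
  finally show ?thesis .
qed

lemma fold1_gsum: "fold1 (gsum f) = f 1"
proof -
  have "fold1 (gsum f) = (\<Sum>t\<in>{0..<int q}. if t = 1 then f t else 0)"
    unfolding gsum_def fold1_sum
  proof (intro sum.cong refl)
    fix t assume "t \<in> {0..<int q}"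
    hence "t mod int q = t" "nat t mod q = nat t" by auto
    thus "fold1 (smult (f t) (xpow t)) = (if t = 1 then f t else 0)"
      by (auto simp: fold1_smult xpow_def fold1_monom)
  qed
  also have "\<dots> = f 1" using q_pos by simp
  finally show ?thesis .
qed

text \<open>The bridge back to Z[\<omega>]: two Gauss sums that agree modulo X^q - 1 and r together
  have coefficients at X that agree modulo r.\<close>

lemma gsum_dcong_imp_dvd:
  assumes "dcong cyc (gsum f) P" "dcong cyc (gsum h) Q" "dcong (of_nat r) P Q"
  shows "of_nat r dvd f 1 - h 1"
proof -
  from assms obtain A B C where "gsum f - P = cyc * A" "gsum h - Q = cyc * B" "P - Q = of_nat r * C"
    unfolding dcong_def by (auto elim!: dvdE)
  hence "gsum f - gsum h = cyc * (A - B) + smult (of_nat r) C"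
    by (simp add: algebra_simps flip: poly_of_nat_mult)
  hence "fold1 (gsum f - gsum h) = of_nat r * fold1 C"
    by (simp add: fold1_add fold1_cyc_mult fold1_smult)
  thus ?thesis by (simp add: fold1_minus fold1_gsum)
qed

lemma gsum_dcong_imp_eq:
  assumes "dcong cyc (gsum f) (gsum h)" shows "f 1 = h 1"
  \<comment> \<open>For r = 0 divisibility by r is equality with zero.\<close>
  using gsum_dcong_imp_dvd[OF assms dcong_refl, of 0] by (simp add: dcong_def)

lemma gsum_smult: "gsum (\<lambda>t. a * f t) = smult a (gsum f)"
  using sum_distrib_left[of "[:a:]" "\<lambda>t. smult (f t) (xpow t)" "{0..<int q}"]
  by (simp add: gsum_def mult.commute)

text \<open>Multiplication modulo X^q - 1 is convolution over the residues modulo q, so products of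
  Gauss sums reduce to the convolutions computed next.\<close>

lemma gsum_mult:
  assumes "\<And>t. h (t mod int q) = h t"
  shows "dcong cyc (gsum f * gsum h) (gsum (\<lambda>u. \<Sum>s\<in>{0..<int q}. f s * h (u - s)))"
proof -
  have "gsum f * gsum h = (\<Sum>s\<in>{0..<int q}. \<Sum>t\<in>{0..<int q}. smult (f s * h t) (xpow s * xpow t))"
    by (simp add: gsum_def sum_product mult_ac)
  also have "dcong cyc \<dots> (\<Sum>s\<in>{0..<int q}. \<Sum>t\<in>{0..<int q}. smult (f s * h t) (xpow (s + t)))"
  proof (intro dcong_sum)
    fix s t
    have "dcong cyc ([:f s * h t:] * (xpow s * xpow t)) ([:f s * h t:] * xpow (s + t))"
      by (intro dcong_mult xpow_mult) simp
    thus "dcong cyc (smult (f s * h t) (xpow s * xpow t)) (smult (f s * h t) (xpow (s + t)))" by simp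
  qed
  also have "(\<Sum>s\<in>{0..<int q}. \<Sum>t\<in>{0..<int q}. smult (f s * h t) (xpow (s + t)))
      = (\<Sum>s\<in>{0..<int q}. \<Sum>u\<in>{0..<int q}. smult (f s * h (u - s)) (xpow u))"
  proof (rule sum.cong[OF refl])
    fix s
    let ?h = "\<lambda>t. smult (f s * h t) (xpow (s + t))"
    have p: "?h (t mod int q) = ?h t" for t
    proof -
      have "xpow (s + t mod int q) = xpow (s + t)"
        using xpow_mod[of "s + t mod int q"] xpow_mod[of "s + t"] by (simp add: mod_add_right_eq)
      thus ?thesis by (simp add: assms)
    qed
    have "(\<Sum>u\<in>{0..<int q}. ?h (u - s)) = (\<Sum>t\<in>{0..<int q}. ?h t)"
      using q_pos p by (intro sum_residues_diff) auto
    thus "(\<Sum>t\<in>{0..<int q}. ?h t) = (\<Sum>u\<in>{0..<int q}. smult (f s * h (u - s)) (xpow u))"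
      by simp
  qed
  also have "\<dots> = gsum (\<lambda>u. \<Sum>s\<in>{0..<int q}. f s * h (u - s))"
    unfolding gsum_def smult_sum by (rule sum.swap)
  finally show ?thesis .
qed

definition chi_cnj :: "int \<Rightarrow> eis" where "chi_cnj t = eis_cnj (chi t)"

text \<open>This is q times the indicator of 0 minus the constant 1. Convolution with it multiplies
  \<open>chi\<close> by q, since the values of \<open>chi\<close> sum to zero.\<close>

definition triv :: "int \<Rightarrow> eis" where "triv t = (if int q dvd t then of_nat q - 1 else - 1)"

definition jacobi_sum :: eis where "jacobi_sum = (\<Sum>t\<in>{0..<int q}. chi t * chi (1 - t))"

lemma chi_cnj_mod [simp]: "chi_cnj (t mod int q) = chi_cnj t"
  by (simp add: chi_cnj_def)

lemma chi_diff_mod [simp]: "chi (u - t mod int q) = chi (u - t)"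
  by (rule chi_cong) (simp add: cong_def mod_diff_right_eq)

lemma triv_mod [simp]: "triv (t mod int q) = triv t"
  by (simp add: triv_def dvd_mod_iff)

lemma coprime_q: "\<not> int q dvd u \<Longrightarrow> coprime u (int q)"
  using q_int prime_imp_coprime coprime_commute by blast

text \<open>For u prime to q the substitution s to u s pulls out chi(u)^2, the conjugate of chi(u).
  For u = 0 the sum becomes the conjugate of \<open>sum_chi\<close>.\<close>

lemma chi_conv_chi: "(\<Sum>s\<in>{0..<int q}. chi s * chi (u - s)) = jacobi_sum * chi_cnj u"
proof (cases "int q dvd u")
  case True
  have "chi s * chi (u - s) = chi_cnj s" for s
  proof -
    have "chi (u - s) = chi (-1 * s)"
      using True by (intro chi_cong) (simp add: cong_iff_dvd_diff)
    thus ?thesis by (simp add: chi_mult[of "-1" s, simplified] chi_cnj_def power2_eq_square flip: chi_square)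
  qed
  hence "(\<Sum>s\<in>{0..<int q}. chi s * chi (u - s)) = eis_cnj (\<Sum>s\<in>{0..<int q}. chi s)"
    by (simp add: eis_cnj_sum chi_cnj_def)
  thus ?thesis using True by (simp add: sum_chi chi_cnj_def)
next
  case False
  have "(\<Sum>s\<in>{0..<int q}. chi s * chi (u - s)) = (\<Sum>s\<in>{0..<int q}. chi (u * s) * chi (u - u * s))"
    using q_pos False coprime_q by (intro sum_residues_mult[symmetric]) auto
  also have "\<dots> = (\<Sum>s\<in>{0..<int q}. chi u ^ 2 * (chi s * chi (1 - s)))"
  proof (intro sum.cong refl)
    fix s
    have "u - u * s = u * (1 - s)" by (simp add: algebra_simps)
    thus "chi (u * s) * chi (u - u * s) = chi u ^ 2 * (chi s * chi (1 - s))"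
      by (simp add: chi_mult power2_eq_square)
  qed
  finally show ?thesis by (simp add: jacobi_sum_def chi_cnj_def chi_square mult.commute flip: sum_distrib_left)
qed

lemma chi_cnj_conv: "(\<Sum>s\<in>{0..<int q}. chi_cnj s * chi_cnj (u - s)) = eis_cnj jacobi_sum * chi u"
  using arg_cong[OF chi_conv_chi, of eis_cnj] by (simp add: eis_cnj_sum chi_cnj_def)

lemma sum_card_residues: "(\<Sum>t\<in>{0..<int q}. if int q dvd t then a else b) = a + of_nat (q - 1) * (b :: eis)"
proof -
  have "{0..<int q} = insert 0 {1..<int q}" using q_pos by auto
  moreover have "(\<Sum>t\<in>{1..<int q}. if int q dvd t then a else b) = (\<Sum>t\<in>{1..<int q}. b)"
    by (intro sum.cong) (auto dest: zdvd_imp_le)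
  ultimately show ?thesis using q_pos by (simp add: nat_diff_distrib)
qed

text \<open>Rescaling s by u shows that the value is one constant K for all u prime to q. Summing
  over all u determines it: the double sum vanishes by \<open>sum_chi\<close>, so (q - 1)(1 + K) =
  0.\<close>

lemma chi_conv_chi_cnj: "(\<Sum>s\<in>{0..<int q}. chi s * chi_cnj (u - s)) = triv u"
proof -
  define K where "K = (\<Sum>s\<in>{0..<int q}. chi s * chi_cnj (1 - s))"
  have m: "chi_cnj (v - t mod int q) = chi_cnj (v - t)" for v t
    by (simp add: chi_cnj_def)
  have q0: "(\<Sum>s\<in>{0..<int q}. chi s * chi_cnj (u - s)) = of_nat (q - 1)" if "int q dvd u" for u
  proof -
    have "chi s * chi_cnj (u - s) = (if int q dvd s then 0 else 1)" for s
    proof -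
      have "chi (u - s) = chi (-1 * s)"
        using that by (intro chi_cong) (simp add: cong_iff_dvd_diff)
      thus ?thesis using chi_mult_cnj[of s] by (simp add: chi_mult[of "-1" s, simplified] chi_cnj_def)
    qed
    thus ?thesis using sum_card_residues[of 0 1] by simp
  qed
  have K: "(\<Sum>s\<in>{0..<int q}. chi s * chi_cnj (u - s)) = K" if u: "\<not> int q dvd u" for u
  proof -
    have "(\<Sum>s\<in>{0..<int q}. chi s * chi_cnj (u - s))
        = (\<Sum>s\<in>{0..<int q}. chi (u * s) * chi_cnj (u - u * s))"
      using q_pos u coprime_q m by (intro sum_residues_mult[symmetric]) auto
    also have "\<dots> = (\<Sum>s\<in>{0..<int q}. chi s * chi_cnj (1 - s))"
    proof (intro sum.cong refl)
      fix s
      have "u - u * s = u * (1 - s)" by (simp add: algebra_simps)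
      hence "chi (u * s) * chi_cnj (u - u * s)
          = (chi u * eis_cnj (chi u)) * (chi s * chi_cnj (1 - s))"
        by (simp add: chi_mult chi_cnj_def mult_ac)
      thus "chi (u * s) * chi_cnj (u - u * s) = chi s * chi_cnj (1 - s)"
        using chi_mult_cnj[OF u] by simp
    qed
    finally show ?thesis by (simp add: K_def)
  qed
  have "(\<Sum>u\<in>{0..<int q}. \<Sum>s\<in>{0..<int q}. chi s * chi_cnj (u - s))
      = (\<Sum>s\<in>{0..<int q}. chi s * (\<Sum>u\<in>{0..<int q}. chi_cnj (u - s)))"
    by (subst sum.swap) (simp add: sum_distrib_left)
  also have "\<dots> = (\<Sum>s\<in>{0..<int q}. chi s * (\<Sum>u\<in>{0..<int q}. chi_cnj u))"
    using q_pos by (subst sum_residues_diff) auto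
  also have "\<dots> = 0" by (simp add: sum_chi flip: sum_distrib_right)
  also have "(\<Sum>u\<in>{0..<int q}. \<Sum>s\<in>{0..<int q}. chi s * chi_cnj (u - s))
      = (\<Sum>u\<in>{0..<int q}. if int q dvd u then of_nat (q - 1) else K)"
    by (intro sum.cong) (auto simp: q0 K)
  also have "\<dots> = of_nat (q - 1) * (1 + K)"
    by (simp only: sum_card_residues) (simp add: algebra_simps)
  finally have "of_nat (q - 1) * (1 + K) = 0" .
  moreover have "of_nat (q - 1) \<noteq> (0 :: eis)" using q_pos by (subst of_nat_eq_0_iff) simp
  ultimately have "K = -1" by (simp add: add_eq_0_iff)
  thus ?thesis using K[of u] q0[of u] q_pos by (auto simp: triv_def of_nat_diff)
qed

lemma chi_conv_triv: "(\<Sum>s\<in>{0..<int q}. triv s * chi (u - s)) = of_nat q * chi u"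
proof -
  have "(\<Sum>s\<in>{0..<int q}. triv s * chi (u - s))
      = (\<Sum>s\<in>{0..<int q}. (if int q dvd s then of_nat q else 0) * chi (u - s) - chi (u - s))"
    by (intro sum.cong) (auto simp: triv_def algebra_simps)
  also have "\<dots> = (\<Sum>s\<in>{0..<int q}. if int q dvd s then of_nat q * chi u else 0)
      - (\<Sum>s\<in>{0..<int q}. chi (u - s))"
  proof -
    have "(if int q dvd s then of_nat q else 0) * chi (u - s)
        = (if int q dvd s then of_nat q * chi u else 0)" for s
      using chi_cong[of "u - s" u] by (simp add: cong_iff_dvd_diff)
    thus ?thesis by (simp add: sum_subtractf)
  qed
  also have "(\<Sum>s\<in>{0..<int q}. chi (u - s)) = 0"
    using q_pos sum_residues_reindex[of "int q" chi "\<lambda>s. u - s"]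
    by (simp add: sum_chi cong_iff_dvd_diff dvd_diff_commute)
  finally show ?thesis by (simp only: sum_card_residues) simp
qed

end

lemma dcong_smult: "dcong D P Q \<Longrightarrow> dcong D (smult a P) (smult a Q)"
  using dcong_mult[of D "[:a:]" "[:a:]" P Q] by simp

section \<open>The cubic residue symbol modulo rational primes\<close>

lemma int_fermat: "prime r \<Longrightarrow> dcong (int r) (x ^ r) x"
proof (induction x rule: int_induct[where k = 0])
  case base
  thus ?case using prime_gt_0_nat[of r] by (simp add: zero_power)
next
  case (step1 i)
  have "dcong (int r) ((i + 1) ^ r) (i ^ r + 1 ^ r)"
    using dcong_power_add_prime[of r i 1] step1 by simp
  also have "dcong (int r) (i ^ r + 1 ^ r) (i + 1)" using step1 by (intro dcong_add) auto
  finally show ?case .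
next
  case (step2 i)
  have "dcong (int r) (i - 1) (i ^ r - 1)"
    using step2 by (intro dcong_diff dcong_sym[of _ "i ^ r" i]) auto
  also have "dcong (int r) (i ^ r - 1) ((i - 1) ^ r + 1 ^ r - 1)"
    using dcong_power_add_prime[of r "i - 1" 1] step2 by (intro dcong_diff) auto
  finally have "dcong (int r) (i - 1) ((i - 1) ^ r)" by simp
  thus ?case by (rule dcong_sym)
qed

lemma dcong_of_int: "dcong (int r) x y \<Longrightarrow> dcong (of_nat r) (of_int x :: eis) (of_int y)"
  by (simp add: dcong_def eis_of_nat_dvd_iff)

lemma eis_decompose: "a = of_int (eis_re a) + of_int (eis_om a) * omega"
  by (simp add: eis_eq_iff)

lemma eis_frobenius:
  assumes "prime r"
  shows "dcong (of_nat r) (a ^ r) (of_int (eis_re a) + of_int (eis_om a) * om (int r))"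
proof -
  have "dcong (of_nat r) (a ^ r) (of_int (eis_re a) ^ r + (of_int (eis_om a) * omega) ^ r)"
    using dcong_power_add_prime[OF assms, of "of_int (eis_re a)" "of_int (eis_om a) * omega"]
    by (simp flip: eis_decompose)
  also have "of_int (eis_re a) ^ r + (of_int (eis_om a) * omega) ^ r
      = of_int (eis_re a ^ r) + of_int (eis_om a ^ r) * om (int r)"
    by (simp add: power_mult_distrib omega_power)
  also have "dcong (of_nat r) \<dots> (of_int (eis_re a) + of_int (eis_om a) * om (int r))"
    by (intro dcong_add dcong_mult dcong_of_int int_fermat assms) auto
  finally show ?thesis .
qed

lemma prime_mod_3:
  assumes "prime (r::nat)" "r \<noteq> 3" shows "r mod 3 = 1 \<or> r mod 3 = 2"
proof -
  have "\<not> 3 dvd r" using assms primes_dvd_imp_eq[of 3 r] by auto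
  thus ?thesis by presburger
qed

lemma eis_frobenius_1:
  assumes "prime r" "r mod 3 = 1" shows "dcong (of_nat r) (a ^ r) (a :: eis)"
proof -
  have "int r mod 3 = 1" using assms(2) by presburger
  hence "om (int r) = omega" using om_cases[of "int r"] by auto
  thus ?thesis using eis_frobenius[OF assms(1), of a] by (simp flip: eis_decompose)
qed

lemma eis_frobenius_2:
  assumes "prime r" "r mod 3 = 2" shows "dcong (of_nat r) (a ^ r) (eis_cnj a)"
proof -
  have "int r mod 3 = 2" using assms(2) by presburger
  hence "om (int r) = -1 - omega" using om_cases[of "int r"] by auto
  hence "of_int (eis_re a) + of_int (eis_om a) * om (int r) = eis_cnj a"
    by (simp add: eis_eq_iff)
  thus ?thesis using eis_frobenius[OF assms(1), of a] by simp
qed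

lemma eis_fermat:
  assumes "prime r" "r = 3 * i + 1" "\<not> int r dvd eis_norm a"
  shows "dcong (of_nat r) (a ^ (3 * i)) 1"
proof -
  have "dcong (of_nat r) (a ^ r) a" using assms by (intro eis_frobenius_1) auto
  hence "of_nat r dvd (a ^ (3 * i) - 1) * a" by (simp add: dcong_def assms(2) algebra_simps)
  \<comment> \<open>The conjugate turns the factor a into its norm, an integer prime to r that can
    be cancelled.\<close>
  hence "of_nat r dvd (a ^ (3 * i) - 1) * a * eis_cnj a" by (rule dvd_mult2)
  hence "of_nat r dvd of_int (eis_norm a) * (a ^ (3 * i) - 1)"
    by (simp add: mult_ac flip: eis_mult_cnj)
  thus ?thesis using eis_dvd_of_int_cancel assms(1,3) unfolding dcong_def by blast
qed

section \<open>The Lucas sequence and the symbol of \<open>\<beta>\<close>\<close>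

lemma eis_cnj_dcong: "dcong (of_nat r) a b \<Longrightarrow> dcong (of_nat r) (eis_cnj a) (eis_cnj b)"
proof -
  assume "dcong (of_nat r) a b"
  then obtain w where "a - b = of_nat r * w" unfolding dcong_def by (elim dvdE)
  hence "eis_cnj a - eis_cnj b = of_nat r * eis_cnj w"
    by (metis eis_cnj_simps(7,8,11))
  thus ?thesis by (simp add: dcong_def)
qed

text \<open>
  The cubic residue symbol of \<open>a\<close> modulo a rational prime \<open>r\<close>, as a relation: for
  \<open>r \<equiv> 1 (mod 3)\<close> it is the product of the symbols modulo the two primes above \<open>r\<close>, which is
  the residue of \<open>(a / a\<^sup>*) ^ ((r - 1) / 3)\<close>; for \<open>r \<equiv> 2 (mod 3)\<close> one has \<open>a\<^sup>r \<equiv> a\<^sup>*\<close>, so that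
  \<open>a ^ ((r\<^sup>2 - 1) / 3) \<equiv> (a\<^sup>* / a) ^ ((r + 1) / 3)\<close>.
\<close>

definition csym :: "eis \<Rightarrow> nat \<Rightarrow> eis \<Rightarrow> bool" where
  "csym a r u \<longleftrightarrow> (if r mod 3 = 1
     then dcong (of_nat r) (a ^ ((r - 1) div 3)) (u * eis_cnj a ^ ((r - 1) div 3))
     else dcong (of_nat r) (u * a ^ ((r + 1) div 3)) (eis_cnj a ^ ((r + 1) div 3)))"

lemma csym_mult:
  assumes "csym a r u" "csym b r v" shows "csym (a * b) r (u * v)"
proof (cases "r mod 3 = 1")
  case True
  let ?k = "(r - 1) div 3"
  have "dcong (of_nat r) (a ^ ?k * b ^ ?k) ((u * eis_cnj a ^ ?k) * (v * eis_cnj b ^ ?k))"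
    using assms True by (intro dcong_mult) (auto simp: csym_def)
  moreover have "(u * eis_cnj a ^ ?k) * (v * eis_cnj b ^ ?k) = u * v * eis_cnj (a * b) ^ ?k"
    by (simp add: power_mult_distrib)
  ultimately show ?thesis using True by (simp add: csym_def power_mult_distrib mult_ac)
next
  case False
  let ?k = "(r + 1) div 3"
  have "dcong (of_nat r) ((u * a ^ ?k) * (v * b ^ ?k)) (eis_cnj a ^ ?k * eis_cnj b ^ ?k)"
    using assms False by (intro dcong_mult) (auto simp: csym_def)
  moreover have "(u * a ^ ?k) * (v * b ^ ?k) = u * v * (a * b) ^ ?k"
    by (simp add: power_mult_distrib)
  ultimately show ?thesis using False by (simp add: csym_def power_mult_distrib mult_ac)
qed

lemma csym_dcong:
  assumes "csym a r u" "dcong (of_nat r) a b" shows "csym b r u"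
proof -
  note c = dcong_power[OF assms(2)] dcong_power[OF eis_cnj_dcong[OF assms(2)]]
  show ?thesis
  proof (cases "r mod 3 = 1")
    case True
    let ?k = "(r - 1) div 3"
    have "dcong (of_nat r) (b ^ ?k) (a ^ ?k)" by (rule dcong_sym[OF c(1)])
    also have "dcong (of_nat r) (a ^ ?k) (u * eis_cnj a ^ ?k)" using assms(1) True by (simp add: csym_def)
    also have "dcong (of_nat r) (u * eis_cnj a ^ ?k) (u * eis_cnj b ^ ?k)" by (intro dcong_mult c) simp
    finally show ?thesis using True by (simp add: csym_def)
  next
    case False
    let ?k = "(r + 1) div 3"
    have "dcong (of_nat r) (u * b ^ ?k) (u * a ^ ?k)" by (intro dcong_mult dcong_sym[OF c(1)]) simp
    also have "dcong (of_nat r) (u * a ^ ?k) (eis_cnj a ^ ?k)" using assms(1) False by (simp add: csym_def)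
    also have "dcong (of_nat r) (eis_cnj a ^ ?k) (eis_cnj b ^ ?k)" by (intro c)
    finally show ?thesis using False by (simp add: csym_def)
  qed
qed

text \<open>The norm is prime to r, so a and its conjugate can be cancelled modulo r; what remains
  is that r divides a difference of two cube roots of unity.\<close>

lemma csym_unique:
  assumes "prime r" "\<not> int r dvd eis_norm a" "csym a r (om e)" "csym a r (om f)"
  shows "om e = om f"
proof -
  obtain k where "of_nat r dvd (om e - om f) * a ^ k \<or> of_nat r dvd (om e - om f) * eis_cnj a ^ k"
  proof (cases "r mod 3 = 1")
    case True
    let ?k = "(r - 1) div 3"
    have "dcong (of_nat r) (a ^ ?k) (om e * eis_cnj a ^ ?k)"
      "dcong (of_nat r) (a ^ ?k) (om f * eis_cnj a ^ ?k)"
      using assms(3,4) True by (simp_all add: csym_def)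
    hence "dcong (of_nat r) (om e * eis_cnj a ^ ?k) (om f * eis_cnj a ^ ?k)"
      by (rule dcong_trans[OF dcong_sym])
    thus ?thesis using that[of "(r - 1) div 3"] by (simp add: dcong_def left_diff_distrib)
  next
    case False
    let ?k = "(r + 1) div 3"
    have "dcong (of_nat r) (om e * a ^ ?k) (eis_cnj a ^ ?k)"
      "dcong (of_nat r) (om f * a ^ ?k) (eis_cnj a ^ ?k)"
      using assms(3,4) False by (simp_all add: csym_def)
    hence "dcong (of_nat r) (om e * a ^ ?k) (om f * a ^ ?k)"
      by (rule dcong_trans[OF _ dcong_sym])
    thus ?thesis using that[of "(r + 1) div 3"] by (simp add: dcong_def left_diff_distrib)
  qed
  hence "of_nat r dvd (om e - om f) * (a ^ k * eis_cnj a ^ k)"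
    using dvd_mult2[of "of_nat r" "(om e - om f) * a ^ k" "eis_cnj a ^ k"]
      dvd_mult2[of "of_nat r" "(om e - om f) * eis_cnj a ^ k" "a ^ k"]
    by (auto simp: mult_ac)
  moreover have "a ^ k * eis_cnj a ^ k = of_int (eis_norm a ^ k)"
    by (simp flip: eis_mult_cnj power_mult_distrib)
  ultimately have "of_nat r dvd of_int (eis_norm a ^ k) * (om e - om f)"
    by (simp add: mult.commute)
  moreover have "\<not> int r dvd eis_norm a ^ k" using assms(1,2) prime_dvd_power[of "int r"] by auto
  ultimately have "of_nat r dvd om e - om f" using assms(1) eis_dvd_of_int_cancel by blast
  thus ?thesis using om_dvd_diff_imp_eq assms(1) by blast
qed

lemma csym_real: "dcong (of_nat r) a (eis_cnj a) \<Longrightarrow> csym a r 1"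
  by (simp add: csym_def dcong_power)

lemma csym_of_int: "csym (of_int n) r 1"
  by (rule csym_real) simp

text \<open>For odd r the exponents (r - 1) / 3 and (r + 1) / 3 are even and absorb the sign; modulo
  2 there is no sign.\<close>

lemma csym_imaginary:
  assumes "dcong (of_nat r) (eis_cnj a) (- a)" "prime r" "r \<noteq> 3" shows "csym a r 1"
proof (cases "r = 2")
  case True
  have "dcong (of_nat 2) (- a) a" by (simp add: dcong_def eis_of_nat_dvd_iff)
  hence "dcong (of_nat r) (eis_cnj a) a" using assms(1) True dcong_trans[of "of_nat r" "eis_cnj a" "- a" a] by simp
  thus ?thesis by (intro csym_real) (rule dcong_sym)
next
  case False
  hence "odd r" using assms(2) prime_odd_nat prime_ge_2_nat[of r] by (metis le_neq_implies_less)
  have *: "dcong (of_nat r) (eis_cnj a ^ k) (a ^ k)" if "even k" for k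
    using dcong_power[OF assms(1), of k] that by simp
  show ?thesis
  proof (cases "r mod 3 = 1")
    case True
    hence "even ((r - 1) div 3)" using \<open>odd r\<close> by presburger
    thus ?thesis using dcong_sym[OF *] True by (simp add: csym_def)
  next
    case False
    hence "r mod 3 = 2" using prime_mod_3 assms by blast
    hence "even ((r + 1) div 3)" using \<open>odd r\<close> by presburger
    thus ?thesis using dcong_sym[OF *] False by (simp add: csym_def)
  qed
qed

text \<open>One exponent serves both classes of r: modulo 3 it is 2 i for r = 3 i + 1 and i + 1 for
  r = 3 i + 2. In this form it is additive over factorizations.\<close>

lemma csym_omega:
  assumes "prime r" "r \<noteq> 3" shows "csym omega r (om ((int r ^ 2 - 1) div 3))"
proof (cases "r mod 3 = 1")
  case True
  define i where "i = r div 3"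
  have r: "r = 3 * i + 1" using True i_def by presburger
  have "(int r ^ 2 - 1) div 3 = int i * (3 * int i + 2)"
    by (simp add: r power2_eq_square algebra_simps)
  moreover have "(r - 1) div 3 = i" using r by simp
  moreover have "omega ^ i = om (int i * (3 * int i + 2)) * eis_cnj (omega) ^ i"
  proof -
    have "eis_cnj omega ^ i = om (2 * int i)" using om_cnj[of "int i"] by (simp flip: omega_power)
    moreover have "[int i = int i * (3 * int i + 2) + 2 * int i] (mod 3)"
      unfolding cong_iff_dvd_diff by (intro dvdI[of _ _ "- int i * int i - int i"]) (simp add: algebra_simps)
    ultimately show ?thesis by (simp add: omega_power om_eq_iff flip: om_add)
  qed
  ultimately show ?thesis using True by (simp add: csym_def)
next
  case False
  hence "r mod 3 = 2" using prime_mod_3 assms by blast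
  define i where "i = r div 3"
  have r: "r = 3 * i + 2" using \<open>r mod 3 = 2\<close> i_def by presburger
  have "(int r ^ 2 - 1) div 3 = (int i + 1) * (3 * int i + 1)"
    by (simp add: r power2_eq_square algebra_simps)
  moreover have "(r + 1) div 3 = i + 1" using r by simp
  moreover have "om ((int i + 1) * (3 * int i + 1)) * omega ^ (i + 1) = eis_cnj (omega) ^ (i + 1)"
  proof -
    have "eis_cnj omega ^ (i + 1) = om (2 * int (i + 1))"
      using om_cnj[of "int (i + 1)"] by (simp only: flip: omega_power) simp
    moreover have "[(int i + 1) * (3 * int i + 1) + int (i + 1) = 2 * int (i + 1)] (mod 3)"
      unfolding cong_iff_dvd_diff by (intro dvdI[of _ _ "int i * int i + int i"]) (simp add: algebra_simps)
    ultimately show ?thesis by (simp only: omega_power om_eq_iff flip: om_add)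
  qed
  ultimately show ?thesis using False by (simp add: csym_def)
qed

lemma csym_power: "csym a r u \<Longrightarrow> csym (a ^ n) r (u ^ n)"
  using csym_of_int[of 1 r] by (induction n) (auto intro: csym_mult)

lemma csym_om:
  assumes "prime r" "r \<noteq> 3" shows "csym (om e) r (om (e * ((int r ^ 2 - 1) div 3)))"
proof -
  have "om (((int r ^ 2 - 1) div 3) * int (nat (e mod 3))) = om (e * ((int r ^ 2 - 1) div 3))"
    by (rule om_cong) (simp add: cong_def mod_mult_left_eq mult.commute)
  thus ?thesis using csym_power[OF csym_omega[OF assms], of "nat (e mod 3)"]
    by (simp add: om_power flip: om_def)
qed

text \<open>Here \<open>1 - \<omega> = \<omega>\<^sup>2 \<surd>-3\<close>.\<close>

lemma csym_one_minus_omega: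
  assumes "prime r" "r \<noteq> 3" shows "csym (1 - omega) r (om (2 * ((int r ^ 2 - 1) div 3)))"
proof -
  have "csym (1 + 2 * omega) r 1"
    using assms by (intro csym_imaginary) (auto simp: dcong_def eis_of_nat_dvd_iff)
  hence "csym (om 2 * (1 + 2 * omega)) r (om (2 * ((int r ^ 2 - 1) div 3)) * 1)"
    using csym_mult csym_om assms by blast
  moreover have "om 2 * (1 + 2 * omega) = 1 - omega"
    using om_cases[of 2] by (auto simp: eis_eq_iff)
  ultimately show ?thesis by simp
qed

lemma square_eq_3_mult_plus_1:
  fixes z :: int
  assumes "\<not> 3 dvd z" obtains Z where "z * z = 3 * Z + 1"
proof -
  have "z mod 3 = 1 \<or> z mod 3 = 2" using assms by presburger
  hence "3 dvd z - 1 \<or> 3 dvd z + 1" by presburger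
  moreover have "z * z - 1 = (z - 1) * (z + 1)" by (simp add: algebra_simps)
  ultimately have "3 dvd z * z - 1" by auto
  then obtain Z where "z * z - 1 = 3 * Z" by (elim dvdE)
  thus ?thesis using that[of Z] by simp
qed

text \<open>The correction (a^2 - 1)(b^2 - 1) is divisible by 9. This makes exponents of the form
  (z^2 - 1) / 3 compatible with multiplicative characters.\<close>

lemma square_minus_1_div_3_mult:
  fixes a b :: int
  assumes "\<not> 3 dvd a" "\<not> 3 dvd b"
  shows "[((a * b) ^ 2 - 1) div 3 = (a ^ 2 - 1) div 3 + (b ^ 2 - 1) div 3] (mod 3)"
proof -
  obtain u v where "a * a = 3 * u + 1" "b * b = 3 * v + 1"
    using square_eq_3_mult_plus_1[OF assms(1)] square_eq_3_mult_plus_1[OF assms(2)] by metis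
  hence u: "a ^ 2 - 1 = 3 * u" and v: "b ^ 2 - 1 = 3 * v" by (simp_all add: power2_eq_square)
  have "(a * b) ^ 2 - 1 = (a ^ 2 - 1) * (b ^ 2 - 1) + (a ^ 2 - 1) + (b ^ 2 - 1)"
    by (simp add: algebra_simps power_mult_distrib)
  also have "\<dots> = 3 * (3 * u * v + u + v)" unfolding u v by (simp add: algebra_simps)
  finally have "((a * b) ^ 2 - 1) div 3 = 3 * u * v + u + v" by simp
  thus ?thesis by (simp add: u v cong_iff_dvd_diff)
qed

text \<open>Reciprocity speaks about primes only; this extends its values to composite n. The
  induction stays among the divisors of n, so that special properties of the primes dividing n can
  be used.\<close>

lemma multiplicative_eq_om:
  fixes \<psi> :: "int \<Rightarrow> eis"
  assumes mult: "\<And>a b. \<psi> (a * b) = \<psi> a * \<psi> b" and units: "\<psi> 1 = 1" "\<psi> (-1) = 1"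
    and primes: "\<And>r. prime r \<Longrightarrow> int r dvd n \<Longrightarrow> \<psi> (int r) = om (j * ((int r ^ 2 - 1) div 3))"
    and "\<not> 3 dvd n"
  shows "\<psi> n = om (j * ((n ^ 2 - 1) div 3))"
proof -
  have *: "\<psi> (int m) = om (j * ((int m ^ 2 - 1) div 3))" if "int m dvd n" for m
    using that
  proof (induction m rule: less_induct)
    case (less m)
    have "m \<noteq> 0" using less.prems assms(5) by (intro notI) simp
    show ?case
    proof (cases "m = 1")
      case False
      then obtain r where r: "prime r" "r dvd m" using prime_factor_nat by blast
      then obtain l where l: "m = r * l" by blast
      have d: "int r dvd n" "int l dvd n" using less.prems l by (auto dest: dvd_mult_left dvd_mult_right)
      have "l < m" using l r(1) \<open>m \<noteq> 0\<close> prime_gt_1_nat[OF r(1)] by simp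
      have "\<not> 3 dvd int r" "\<not> 3 dvd int l" using d assms(5) by (meson dvd_trans)+
      hence "[j * ((int m ^ 2 - 1) div 3) = j * ((int r ^ 2 - 1) div 3 + (int l ^ 2 - 1) div 3)] (mod 3)"
        unfolding l of_nat_mult by (intro cong_mult square_minus_1_div_3_mult) auto
      hence "om (j * ((int m ^ 2 - 1) div 3))
          = om (j * ((int r ^ 2 - 1) div 3) + j * ((int l ^ 2 - 1) div 3))"
        by (intro om_cong) (simp add: algebra_simps)
      also have "\<dots> = \<psi> (int r) * \<psi> (int l)"
        using primes[OF r(1) d(1)] less.IH[OF \<open>l < m\<close> d(2)] by (simp add: om_add)
      finally show ?thesis by (simp add: l mult)
    qed (simp add: units)
  qed
  show ?thesis
  proof (cases "n \<ge> 0")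
    case True
    thus ?thesis using *[of "nat n"] by simp
  next
    case False
    thus ?thesis using *[of "nat (-n)"] mult[of "-1" "-n"] units by simp
  qed
qed

section \<open>Reciprocity\<close>

context cubic_prime
begin

lemma gsum_chi_sq: "dcong cyc (gsum chi * gsum chi) (smult jacobi_sum (gsum chi_cnj))"
  using gsum_mult[of chi chi] by (simp add: chi_conv_chi gsum_smult)

lemma gsum_chi_cnj_sq: "dcong cyc (gsum chi_cnj * gsum chi_cnj) (smult (eis_cnj jacobi_sum) (gsum chi))"
  using gsum_mult[of chi_cnj chi_cnj] by (simp add: chi_cnj_conv gsum_smult)

lemma gsum_chi_cube: "dcong cyc (gsum chi ^ 3) (smult jacobi_sum (gsum triv))"
proof -
  have "dcong cyc (gsum chi * (gsum chi * gsum chi)) (gsum chi * smult jacobi_sum (gsum chi_cnj))"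
    by (intro dcong_mult gsum_chi_sq dcong_refl)
  also have "gsum chi * smult jacobi_sum (gsum chi_cnj) = smult jacobi_sum (gsum chi * gsum chi_cnj)"
    by simp
  also have "dcong cyc \<dots> (smult jacobi_sum (gsum triv))"
    using gsum_mult[of chi_cnj chi] by (intro dcong_smult) (simp add: chi_conv_chi_cnj)
  finally show ?thesis by (simp add: power3_eq_cube mult.assoc)
qed

text \<open>The classical g^3 = q J takes this form modulo X^q - 1: one further factor g turns
  \<open>gsum triv\<close> into q.\<close>

lemma gsum_chi_4: "dcong cyc (gsum chi ^ 4) (smult (of_nat q * jacobi_sum) (gsum chi))"
proof -
  have "dcong cyc (gsum chi ^ 3 * gsum chi) (smult jacobi_sum (gsum triv) * gsum chi)"
    by (intro dcong_mult gsum_chi_cube dcong_refl)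
  also have "smult jacobi_sum (gsum triv) * gsum chi = smult jacobi_sum (gsum triv * gsum chi)"
    by simp
  also have "dcong cyc \<dots> (smult jacobi_sum (smult (of_nat q) (gsum chi)))"
    using gsum_mult[of chi triv] by (intro dcong_smult) (simp add: chi_conv_triv gsum_smult)
  finally show ?thesis by (simp add: mult.commute power4_eq_xxxx power3_eq_cube mult.assoc)
qed

text \<open>Modulo r the r-th power may be taken term by term, and the reindexing u = r t moves r'
  into the argument of \<open>chi\<close>. The intermediate Q separates the two moduli r and X^q -
  1.\<close>

lemma gsum_frobenius:
  assumes r: "prime r" "r \<noteq> q" and r': "[int r * r' = 1] (mod int q)"
  obtains Q where "dcong (of_nat r) (gsum chi ^ r) Q" "dcong cyc (gsum (\<lambda>u. chi (r' * u) ^ r)) Q"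
proof -
  define Q where "Q = (\<Sum>t\<in>{0..<int q}. smult (chi t) (xpow t) ^ r)"
  have "dcong (of_nat r) (gsum chi ^ r) Q"
    unfolding gsum_def Q_def by (rule dcong_sum_power_prime) (use r in auto)
  moreover have "dcong cyc Q (gsum (\<lambda>u. chi (r' * u) ^ r))"
  proof -
    have "dcong cyc Q (\<Sum>t\<in>{0..<int q}. smult (chi t ^ r) (xpow (t * int r)))"
      unfolding Q_def smult_power by (intro dcong_sum dcong_smult xpow_power)
    also have "(\<Sum>t\<in>{0..<int q}. smult (chi t ^ r) (xpow (t * int r)))
        = (\<Sum>t\<in>{0..<int q}. smult (chi (r' * (int r * t)) ^ r) (xpow (int r * t)))"
    proof (rule sum.cong[OF refl])
      fix t
      have "[int r * r' * t = 1 * t] (mod int q)" using r' by (rule cong_mult) simp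
      hence "chi (r' * (int r * t)) = chi t" by (intro chi_cong) (simp add: mult_ac)
      thus "smult (chi t ^ r) (xpow (t * int r)) = smult (chi (r' * (int r * t)) ^ r) (xpow (int r * t))"
        by (simp add: mult.commute)
    qed
    also have "\<dots> = gsum (\<lambda>u. chi (r' * u) ^ r)"
      unfolding gsum_def
    proof (rule sum_residues_mult)
      show "int q > 0" using q_pos by simp
      show "coprime (int r) (int q)" using r q primes_coprime[of r q] by (simp add: coprime_int_iff)
      have "chi (r' * (t mod int q)) = chi (r' * t)" for t
        by (rule chi_cong) (simp add: cong_def mod_mult_right_eq)
      thus "smult (chi (r' * (t mod int q)) ^ r) (xpow (t mod int q)) = smult (chi (r' * t) ^ r) (xpow t)" for t
        by simp
    qed
    finally show ?thesis .
  qed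
  ultimately show ?thesis using that dcong_sym by blast
qed

lemma prime_inverse_mod:
  assumes "prime r" "r \<noteq> q" obtains r' where "[int r * r' = 1] (mod int q)" "chi r' * chi (int r) = 1"
proof -
  have "coprime (int r) (int q)" using assms q primes_coprime[of r q] by (simp add: coprime_int_iff)
  then obtain r' where r': "[int r * r' = 1] (mod int q)" using cong_solve_coprime_int by blast
  hence "chi (int r * r') = chi 1" by (rule chi_cong)
  thus ?thesis using that r' by (simp add: chi_mult mult.commute)
qed

text \<open>The case r = 3 of the two evaluations: at X the coefficient of g^3 is - J by
  \<open>gsum_chi_cube\<close>, and it is a cube of a root of unity, hence 1, by Frobenius.\<close>

lemma jacobi_sum_mod_3: "of_nat 3 dvd jacobi_sum + 1"
proof -
  have "3 \<noteq> q" using qk by presburger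
  then obtain r' where r': "[int 3 * r' = 1] (mod int q)" "chi r' * chi (int 3) = 1"
    using prime_inverse_mod[of 3] by auto
  have p3: "prime (3::nat)" by simp
  obtain Q where Q: "dcong (of_nat 3) (gsum chi ^ 3) Q" "dcong cyc (gsum (\<lambda>u. chi (r' * u) ^ 3)) Q"
    using gsum_frobenius[OF p3 \<open>3 \<noteq> q\<close> r'(1)] .
  have "dcong cyc (gsum (\<lambda>u. jacobi_sum * triv u)) (gsum chi ^ 3)"
    unfolding gsum_smult by (rule dcong_sym[OF gsum_chi_cube])
  from gsum_dcong_imp_dvd[OF this Q(2,1)]
  have "of_nat 3 dvd jacobi_sum * triv 1 - chi (r' * 1) ^ 3" .
  moreover have "chi r' ^ 3 = 1"
  proof (rule chi_cube, rule notI)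
    assume "int q dvd r'"
    thus False using r'(2) by simp
  qed
  moreover have "triv 1 = -1" using q_pos by (simp add: triv_def)
  ultimately have "of_nat 3 dvd - (jacobi_sum + 1)" by simp
  thus ?thesis by (simp only: dvd_minus_iff)
qed

lemma jacobi_sum_not_0: "jacobi_sum \<noteq> 0"
  using jacobi_sum_mod_3 unfolding eis_of_nat_dvd_iff by auto

text \<open>Two evaluations of g^4 are compared: as the square of g^2 and as g^3 times g. The common
  factor J is nonzero because it is -1 modulo 3.\<close>

lemma jacobi_sum_mult_cnj: "jacobi_sum * eis_cnj jacobi_sum = of_nat q"
proof -
  let ?J = jacobi_sum
  have "dcong cyc ((gsum chi * gsum chi) * (gsum chi * gsum chi))
      (smult ?J (gsum chi_cnj) * smult ?J (gsum chi_cnj))"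
    by (intro dcong_mult gsum_chi_sq)
  also have "smult ?J (gsum chi_cnj) * smult ?J (gsum chi_cnj) = smult (?J ^ 2) (gsum chi_cnj * gsum chi_cnj)"
    by (simp add: power2_eq_square)
  also have "dcong cyc \<dots> (smult (?J ^ 2) (smult (eis_cnj ?J) (gsum chi)))"
    by (intro dcong_smult gsum_chi_cnj_sq)
  also have "\<dots> = gsum (\<lambda>u. ?J ^ 2 * eis_cnj ?J * chi u)" by (simp add: gsum_smult)
  finally have "dcong cyc (gsum chi ^ 4) (gsum (\<lambda>u. ?J ^ 2 * eis_cnj ?J * chi u))"
    by (simp add: power4_eq_xxxx mult.assoc)
  moreover have "dcong cyc (gsum (\<lambda>u. of_nat q * ?J * chi u)) (gsum chi ^ 4)"
    unfolding gsum_smult by (rule dcong_sym[OF gsum_chi_4])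
  ultimately have "dcong cyc (gsum (\<lambda>u. of_nat q * ?J * chi u)) (gsum (\<lambda>u. ?J ^ 2 * eis_cnj ?J * chi u))"
    using dcong_trans by blast
  from gsum_dcong_imp_eq[OF this] have "?J * of_nat q = ?J * (?J * eis_cnj ?J)"
    by (simp add: power2_eq_square mult_ac)
  thus ?thesis using jacobi_sum_not_0 by simp
qed

lemma eis_norm_jacobi_sum: "eis_norm jacobi_sum = int q"
  using jacobi_sum_mult_cnj by (simp add: eis_mult_cnj eis_eq_iff)

text \<open>This tells which prime above q the Jacobi sum generates. Reduced at \<omega> = c it is
  the sum of (t (1 - t))^k, a polynomial of degree 2 k < q - 1, so all power sums in it vanish
  modulo q.\<close>

lemma jacobi_sum_root: "int q dvd eis_re jacobi_sum + eis_om jacobi_sum * c"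
proof -
  have re: "eis_re (sum f S) = (\<Sum>i\<in>S. eis_re (f i))" and im: "eis_om (sum f S) = (\<Sum>i\<in>S. eis_om (f i))"
    for f :: "int \<Rightarrow> eis" and S by (induction S rule: infinite_finite_induct) auto
  have "eis_re jacobi_sum + eis_om jacobi_sum * c
      = (\<Sum>t\<in>{0..<int q}. eis_re (chi (t * (1 - t))) + eis_om (chi (t * (1 - t))) * c)"
    by (simp only: jacobi_sum_def re im sum_distrib_right sum.distrib chi_mult)
  also have "[\<dots> = (\<Sum>t\<in>{0..<int q}. (t * (1 - t)) ^ k)] (mod int q)"
    by (intro cong_sum c_eval_chi)
  also have "(\<Sum>t\<in>{0..<int q}. (t * (1 - t)) ^ k)
      = (\<Sum>t\<in>{0..<int q}. \<Sum>i\<le>k. of_nat (k choose i) * (-1) ^ i * t ^ (k + i))"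
  proof (rule sum.cong[OF refl])
    fix t :: int
    have "(t * (1 - t)) ^ k = t ^ k * (- t + 1) ^ k" by (simp add: power_mult_distrib)
    also have "(- t + 1) ^ k = (\<Sum>i\<le>k. of_nat (k choose i) * (-t) ^ i * 1 ^ (k - i))"
      by (rule binomial_ring)
    also have "\<dots> = (\<Sum>i\<le>k. of_nat (k choose i) * (-1) ^ i * t ^ i)"
      by (intro sum.cong refl) (subst power_minus, simp)
    finally show "(t * (1 - t)) ^ k = (\<Sum>i\<le>k. of_nat (k choose i) * (-1) ^ i * t ^ (k + i))"
      by (simp add: sum_distrib_left power_add mult_ac)
  qed
  also have "\<dots> = (\<Sum>i\<le>k. of_nat (k choose i) * (-1) ^ i * (\<Sum>t\<in>{0..<int q}. t ^ (k + i)))"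
    by (subst sum.swap) (simp add: sum_distrib_left)
  also have "[\<dots> = 0] (mod int q)"
    unfolding cong_0_iff
  proof (rule dvd_sum)
    fix i assume "i \<in> {..k}"
    hence "k + i < q - 1" using qk k_pos by simp
    thus "int q dvd of_nat (k choose i) * (-1) ^ i * (\<Sum>t\<in>{0..<int q}. t ^ (k + i))"
      by (intro dvd_mult prime_dvd_sum_powers q)
  qed
  finally show ?thesis by (simp add: cong_0_iff)
qed

theorem cubic_reciprocity_rational:
  assumes r: "prime r" "r \<noteq> 3" "r \<noteq> q"
  shows "csym jacobi_sum r (chi (int r))"
proof -
  let ?J = jacobi_sum and ?K = "eis_cnj jacobi_sum"
  obtain r' where r': "[int r * r' = 1] (mod int q)" "chi r' * chi (int r) = 1"
    using prime_inverse_mod r by metis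
  obtain Q where Q: "dcong (of_nat r) (gsum chi ^ r) Q" "dcong cyc (gsum (\<lambda>u. chi (r' * u) ^ r)) Q"
    using gsum_frobenius[OF r(1,3) r'(1)] .
  have nd: "\<not> int q dvd r'" using r'(2) by auto
  have pow: "dcong cyc (gsum chi ^ (3 * i + 1)) (smult ((of_nat q * ?J) ^ i) (gsum chi))" for i
  proof (induction i)
    case (Suc i)
    have "gsum chi ^ (3 * Suc i + 1) = gsum chi ^ (3 * i + 1) * gsum chi ^ 3"
      using power_add[of "gsum chi" "3 * i + 1" 3] by simp
    also have "dcong cyc \<dots> (smult ((of_nat q * ?J) ^ i) (gsum chi) * gsum chi ^ 3)"
      by (intro dcong_mult Suc.IH dcong_refl)
    also have "\<dots> = smult ((of_nat q * ?J) ^ i) (gsum chi ^ 4)"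
      by (simp add: power4_eq_xxxx power3_eq_cube mult.assoc)
    also have "dcong cyc \<dots> (smult ((of_nat q * ?J) ^ i) (smult (of_nat q * ?J) (gsum chi)))"
      by (intro dcong_smult gsum_chi_4)
    finally show ?case by (simp add: mult_ac)
  qed simp
  \<comment> \<open>Writing q as J times its conjugate expresses everything by the two quantities
    that \<open>csym\<close> compares.\<close>
  have qJ: "of_nat q * ?J = ?J ^ 2 * ?K"
    by (simp add: power2_eq_square mult_ac flip: jacobi_sum_mult_cnj)
  show ?thesis
  proof (cases "r mod 3 = 1")
    case True
    define i where "i = r div 3"
    have ri: "r = 3 * i + 1" using True i_def by presburger
    have "dcong cyc (gsum (\<lambda>u. (of_nat q * ?J) ^ i * chi u)) (gsum chi ^ r)"
      unfolding gsum_smult ri by (rule dcong_sym[OF pow])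
    from gsum_dcong_imp_dvd[OF this Q(2,1)]
    have "of_nat r dvd (of_nat q * ?J) ^ i - chi r' ^ r" by simp
    also have "chi r' ^ r = chi r'" using chi_cube[OF nd] by (simp add: ri power_add power_mult)
    finally have 1: "dcong (of_nat r) ((?J ^ 2 * ?K) ^ i) (chi r')" by (simp add: dcong_def qJ)
    \<comment> \<open>Hence J^(2 i) acts as the inverse of J^i, and (J^2 K)^i is the quotient (K /
      J)^i.\<close>
    have 2: "dcong (of_nat r) (?J ^ (3 * i)) 1"
    proof (rule eis_fermat[OF r(1) ri])
      show "\<not> int r dvd eis_norm ?J"
        using r q primes_dvd_imp_eq[of r q] by (auto simp: eis_norm_jacobi_sum)
    qed
    have "dcong (of_nat r) ((?J ^ 2 * ?K) ^ i * (chi (int r) * ?J ^ i)) (chi r' * (chi (int r) * ?J ^ i))"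
      by (rule dcong_mult[OF 1 dcong_refl])
    moreover have "(?J ^ 2 * ?K) ^ i * (chi (int r) * ?J ^ i) = ?J ^ (3 * i) * (chi (int r) * ?K ^ i)"
      by (simp add: power_mult_distrib power_mult power3_eq_cube power2_eq_square mult_ac)
    moreover have "chi r' * (chi (int r) * ?J ^ i) = ?J ^ i"
      using r'(2) by (simp flip: mult.assoc)
    ultimately have "dcong (of_nat r) (?J ^ (3 * i) * (chi (int r) * ?K ^ i)) (?J ^ i)" by simp
    moreover have "dcong (of_nat r) (?J ^ (3 * i) * (chi (int r) * ?K ^ i)) (1 * (chi (int r) * ?K ^ i))"
      by (rule dcong_mult[OF 2 dcong_refl])
    ultimately have "dcong (of_nat r) (?J ^ i) (chi (int r) * ?K ^ i)"
      using dcong_trans[OF dcong_sym] by simp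
    moreover have "(r - 1) div 3 = i" using ri by simp
    ultimately show ?thesis using True by (simp add: csym_def)
  next
    case False
    hence r2: "r mod 3 = 2" using prime_mod_3 r by blast
    define i where "i = r div 3"
    have ri: "r = 3 * i + 2" using r2 i_def by presburger
    have "gsum chi ^ r = gsum chi ^ (3 * i + 1) * gsum chi" by (simp add: ri)
    also have "dcong cyc \<dots> (smult ((of_nat q * ?J) ^ i) (gsum chi) * gsum chi)"
      by (intro dcong_mult pow dcong_refl)
    also have "\<dots> = smult ((of_nat q * ?J) ^ i) (gsum chi * gsum chi)" by simp
    also have "dcong cyc \<dots> (smult ((of_nat q * ?J) ^ i) (smult ?J (gsum chi_cnj)))"
      by (intro dcong_smult gsum_chi_sq)
    also have "\<dots> = gsum (\<lambda>u. (of_nat q * ?J) ^ i * ?J * chi_cnj u)" by (simp add: gsum_smult)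
    finally have "dcong cyc (gsum (\<lambda>u. (of_nat q * ?J) ^ i * ?J * chi_cnj u)) (gsum chi ^ r)"
      by (rule dcong_sym)
    from gsum_dcong_imp_dvd[OF this Q(2,1)]
    have "of_nat r dvd (of_nat q * ?J) ^ i * ?J - chi r' ^ r" by (simp add: chi_cnj_def)
    also have "chi r' ^ r = chi (int r)"
    proof -
      have "chi r' ^ r = chi r' ^ 2" using chi_cube[OF nd] by (simp add: ri power_add power_mult power2_eq_square)
      also have "\<dots> = chi r' ^ 3 * chi (int r)"
        using r'(2) by (simp add: power2_eq_square power3_eq_cube mult.assoc)
      finally show ?thesis using chi_cube[OF nd] by simp
    qed
    finally have 1: "dcong (of_nat r) ((?J ^ 2 * ?K) ^ i * ?J) (chi (int r))" by (simp add: dcong_def qJ)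
    \<comment> \<open>The extra factor J^(i + 1) completes the power of J to J^r, which Frobenius
      replaces by the conjugate.\<close>
    have "dcong (of_nat r) (chi (int r) * ?J ^ (i + 1)) ((?J ^ 2 * ?K) ^ i * ?J * ?J ^ (i + 1))"
      by (intro dcong_mult dcong_sym[OF 1]) simp
    also have "(?J ^ 2 * ?K) ^ i * ?J * ?J ^ (i + 1) = ?J ^ r * ?K ^ i"
      by (simp add: ri power_mult_distrib power_add mult_ac power3_eq_cube power2_eq_square power_mult)
    also have "dcong (of_nat r) \<dots> (?K * ?K ^ i)"
      by (intro dcong_mult eis_frobenius_2 r r2) simp
    finally have "dcong (of_nat r) (chi (int r) * ?J ^ (i + 1)) (?K ^ (i + 1))" by simp
    moreover have "(r + 1) div 3 = i + 1" using ri by simp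
    ultimately show ?thesis using False by (simp add: csym_def)
  qed
qed

lemma jacobi_sum_primary: "3 dvd eis_om jacobi_sum" "3 dvd eis_re jacobi_sum + 1"
  using jacobi_sum_mod_3 unfolding eis_of_nat_dvd_iff by auto

lemma not_q_dvd_om: "\<not> int q dvd eis_om jacobi_sum"
proof
  let ?a = "eis_re jacobi_sum" and ?b = "eis_om jacobi_sum"
  assume b: "int q dvd ?b"
  have "?a * ?a = int q - ?b * (?b - ?a)"
    using eis_norm_jacobi_sum by (simp add: eis_norm_def power2_eq_square algebra_simps)
  hence "int q dvd ?a * ?a" using b by simp
  hence a: "int q dvd ?a" by (simp add: prime_dvd_mult_iff)
  have "int q * int q dvd int q"
  proof -
    obtain u v where "?a = int q * u" "?b = int q * v" using a b by (auto elim!: dvdE)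
    hence "int q = int q * int q * (u * u - u * v + v * v)"
      using eis_norm_jacobi_sum by (simp add: eis_norm_def power2_eq_square algebra_simps)
    thus ?thesis by (metis dvd_triv_left)
  qed
  thus False using q_pos by simp
qed

lemma not_q_dvd_re: "\<not> int q dvd eis_re jacobi_sum"
proof
  assume "int q dvd eis_re jacobi_sum"
  hence "int q dvd eis_om jacobi_sum * c" using jacobi_sum_root dvd_add_right_iff by blast
  thus False using not_q_dvd_om c_coprime q_pos by (auto simp: prime_dvd_mult_iff coprime_absorb_right)
qed

text \<open>
  The supplementary law: with \<open>J = a + b\<omega>\<close>, reciprocity evaluates \<open>chi\<close> at the rational
  integers \<open>a\<close> and \<open>a + b\<close>, and \<open>(a + b)\<^sup>2 c \<equiv> 3 a\<^sup>2\<close> up to a cube, since \<open>a \<equiv> -b c\<close> and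
  \<open>(1 - c)\<^sup>2 \<equiv> -3 c\<close> modulo \<open>q\<close>.
\<close>

lemma chi_3: "chi 3 = om (eis_re jacobi_sum * eis_om jacobi_sum div 3)"
proof -
  let ?J = jacobi_sum
  define a where "a = eis_re ?J"
  define b where "b = eis_om ?J"
  have q_eq: "int q = a\<^sup>2 - a * b + b\<^sup>2"
    using eis_norm_jacobi_sum by (simp add: eis_norm_def a_def b_def)
  have 3: "3 dvd b" "3 dvd a + 1" using jacobi_sum_primary by (simp_all add: a_def b_def)
  have J: "?J = of_int a + of_int b * omega" unfolding a_def b_def by (rule eis_decompose)
  have abc: "[a = - b * c] (mod int q)"
    using jacobi_sum_root by (simp add: cong_iff_dvd_diff a_def b_def)
  have chi_a: "chi a = om (1 * ((a\<^sup>2 - 1) div 3))"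
  proof (rule multiplicative_eq_om)
    show "\<not> 3 dvd a" using 3 by presburger
    fix r assume r: "prime r" "int r dvd a"
    have "r \<noteq> q" using not_q_dvd_re r by (auto simp: a_def)
    have "r \<noteq> 3" using \<open>\<not> 3 dvd a\<close> r by auto
    \<comment> \<open>Modulo a divisor of a only b \<omega> is left of J, so the symbol is that of
      \<omega>.\<close>
    have "dcong (of_nat r) (of_int b * omega) ?J"
      using r(2) by (simp add: dcong_def J eis_of_nat_dvd_iff)
    hence "csym ?J r (1 * om ((int r ^ 2 - 1) div 3))"
      by (rule csym_dcong[rotated]) (intro csym_mult csym_of_int csym_omega r \<open>r \<noteq> 3\<close>)
    moreover have nq: "\<not> int r dvd int q" using r q \<open>r \<noteq> q\<close> primes_dvd_imp_eq[of r q] by auto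
    moreover obtain e where e: "chi (int r) = om e"
      using chi_om[of "int r"] r q \<open>r \<noteq> q\<close> primes_dvd_imp_eq[of q r] by auto
    moreover have "csym ?J r (om e)" using cubic_reciprocity_rational[OF r(1) \<open>r \<noteq> 3\<close> \<open>r \<noteq> q\<close>] e by simp
    ultimately show "chi (int r) = om (1 * ((int r ^ 2 - 1) div 3))"
      using csym_unique[of r ?J e] r(1) by (simp add: eis_norm_jacobi_sum)
  qed (auto simp: chi_mult)
  have chi_ab: "chi (a + b) = om (2 * (((a + b)\<^sup>2 - 1) div 3))"
  proof (rule multiplicative_eq_om)
    show "\<not> 3 dvd a + b" using 3 by presburger
    fix r assume r: "prime r" "int r dvd a + b"
    have "r \<noteq> 3" using \<open>\<not> 3 dvd a + b\<close> r by auto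
    have "r \<noteq> q"
    proof
      assume "r = q"
      hence "int q dvd (a + b) * (a + b) - int q" using r(2) by (intro dvd_diff) auto
      also have "(a + b) * (a + b) - int q = 3 * (a * b)" by (simp add: q_eq power2_eq_square algebra_simps)
      finally show False using not_dvd_3 not_q_dvd_om not_q_dvd_re
        by (simp add: prime_dvd_mult_iff a_def b_def)
    qed
    \<comment> \<open>Modulo a divisor of a + b one may put b = - a.\<close>
    have "dcong (of_nat r) (of_int a * (1 - omega)) ?J"
      using r(2) by (simp add: dcong_def J eis_of_nat_dvd_iff algebra_simps)
        (metis dvd_minus_iff minus_add_distrib uminus_add_conv_diff add.commute)
    hence "csym ?J r (1 * om (2 * ((int r ^ 2 - 1) div 3)))"
      by (rule csym_dcong[rotated]) (intro csym_mult csym_of_int csym_one_minus_omega r \<open>r \<noteq> 3\<close>)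
    moreover have nq: "\<not> int r dvd int q" using r q \<open>r \<noteq> q\<close> primes_dvd_imp_eq[of r q] by auto
    moreover obtain e where e: "chi (int r) = om e"
      using chi_om[of "int r"] r q \<open>r \<noteq> q\<close> primes_dvd_imp_eq[of q r] by auto
    moreover have "csym ?J r (om e)" using cubic_reciprocity_rational[OF r(1) \<open>r \<noteq> 3\<close> \<open>r \<noteq> q\<close>] e by simp
    ultimately show "chi (int r) = om (2 * ((int r ^ 2 - 1) div 3))"
      using csym_unique[of r ?J e] r(1) by (simp add: eis_norm_jacobi_sum)
  qed (auto simp: chi_mult)
  have nc: "\<not> int q dvd c" using c_coprime q_pos by (auto simp: coprime_absorb_right)
  have chi_c: "chi c = om (int k)" using chi_eqI[OF nc, of k] by (simp add: omega_power)
  have chi_a': "chi a = chi b * chi c"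
  proof -
    have "chi a = chi (-1 * (b * c))" using abc by (intro chi_cong) simp
    thus ?thesis by (simp only: chi_mult chi_minus_1) simp
  qed
  have "chi (a + b) = chi (b * (1 - c))"
    using abc by (intro chi_cong) (simp add: cong_iff_dvd_diff algebra_simps)
  moreover have "chi (1 - c) ^ 2 = chi 3 * chi c"
  proof -
    have "[(1 - c)\<^sup>2 = -1 * (3 * c)] (mod int q)"
      using c by (simp add: cong_iff_dvd_diff power2_eq_square algebra_simps)
    hence "chi ((1 - c)\<^sup>2) = chi (-1 * (3 * c))" by (rule chi_cong)
    thus ?thesis by (simp only: chi_mult chi_minus_1 chi_power) simp
  qed
  ultimately have "chi (a + b) ^ 2 * chi c = chi 3 * chi a ^ 2"
    by (simp add: chi_mult chi_a' power2_eq_square mult_ac)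
  moreover define x where "x = (a\<^sup>2 - 1) div 3"
  moreover define y where "y = ((a + b)\<^sup>2 - 1) div 3"
  ultimately have *: "chi 3 * om (2 * x) = om (4 * y + int k)"
    by (simp add: chi_a chi_ab chi_c om_power om_add mult_ac)
  \<comment> \<open>All values are now powers of \<omega>; the rest is an identity between exponents
    modulo 3, with k = (q - 1) / 3 taken from the norm of J.\<close>
  obtain a' b' where ab': "a + 1 = 3 * a'" "b = 3 * b'" using 3 by (auto elim!: dvdE)
  have a: "a = 3 * a' - 1" using ab' by simp
  have x: "x = 3 * a' * a' - 2 * a'"
    unfolding x_def by (simp add: a power2_eq_square algebra_simps)
  have y: "y = 3 * (a' + b') * (a' + b') - 2 * (a' + b')"
    unfolding y_def by (simp add: a ab'(2) power2_eq_square algebra_simps)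
  have k: "int k = 3 * a' * a' - 2 * a' - 3 * a' * b' + b' + 3 * b' * b'"
    using q_eq qk by (simp add: a ab'(2) power2_eq_square algebra_simps)
  have "chi 3 * om (2 * x) * om (- 2 * x) = om (4 * y + int k) * om (- 2 * x)" by (simp add: *)
  hence "chi 3 = om (4 * y + int k - 2 * x)"
    by (simp add: mult.assoc flip: om_add)
  also have "\<dots> = om (a * b')"
  proof (rule om_cong)
    have "4 * y + int k - 2 * x - a * b' = 3 * (3 * a' * a' + 6 * a' * b' + 5 * b' * b' - 2 * a' - 2 * b')"
      unfolding x y k a by (simp add: algebra_simps)
    thus "[4 * y + int k - 2 * x = a * b'] (mod 3)" by (auto simp: cong_iff_dvd_diff)
  qed
  also have "a * b' = a * b div 3" by (simp add: ab'(2))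
  finally show ?thesis by (simp add: a_def b_def)
qed

end

section \<open>Characters modulo primary Eisenstein integers\<close>

text \<open>Equivalently, congruent to 1 or -1 modulo 3. The sign is left free because -1 is a
  cube.\<close>

definition primary :: "eis \<Rightarrow> bool" where
  "primary a \<longleftrightarrow> 3 dvd eis_om a \<and> \<not> 3 dvd eis_re a"

text \<open>
  The fourth conjunct is reciprocity, the last one the supplementary law for \<open>3\<close>.
\<close>

definition cubic_char :: "eis \<Rightarrow> (int \<Rightarrow> eis) \<Rightarrow> bool" where
  "cubic_char a \<psi> \<longleftrightarrow>
     (\<forall>k l. \<psi> (k * l) = \<psi> k * \<psi> l) \<and>
     (\<forall>k. coprime k (eis_norm a) \<longrightarrow> (\<exists>e. \<psi> k = om e)) \<and>
     (\<forall>k l. a dvd of_int (k - l) \<longrightarrow> \<psi> k = \<psi> l) \<and>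
     (\<forall>r. prime r \<and> r \<noteq> 3 \<and> \<not> int r dvd eis_norm a \<longrightarrow> csym a r (\<psi> (int r))) \<and>
     \<psi> 3 = om (eis_re a * eis_om a div 3)"

text \<open>Rational integers have trivial symbol modulo a rational integer prime to them: they are
  cubes modulo inert primes, and conjugate primes contribute inverse values.\<close>

lemma cubic_char_of_int: "cubic_char (of_int n) (\<lambda>_. 1)"
  using om_0 by (auto simp: cubic_char_def csym_of_int simp del: om_0 intro!: exI[of _ 0] om_0[symmetric])

lemma primary_mult_right:
  assumes "primary a" "primary (a * b)" shows "primary b"
proof -
  have "3 dvd eis_re a * eis_om b"
  proof -
    have "eis_re a * eis_om b = eis_om (a * b) - eis_om a * (eis_re b - eis_om b)"
      by (simp add: algebra_simps)
    thus ?thesis using assms by (auto simp: primary_def simp del: eis_simps)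
  qed
  hence "3 dvd eis_om b" using assms(1) by (auto simp: primary_def prime_dvd_mult_iff)
  moreover have "\<not> 3 dvd eis_re b"
  proof
    assume "3 dvd eis_re b"
    hence "3 dvd eis_re a * eis_re b - eis_om a * eis_om b"
      using assms(1) by (auto simp: primary_def)
    thus False using assms(2) by (simp add: primary_def)
  qed
  ultimately show ?thesis by (simp add: primary_def)
qed

lemma cubic_char_mult:
  assumes "primary a" "primary b" "cubic_char a \<psi>" "cubic_char b \<phi>"
  shows "cubic_char (a * b) (\<lambda>k. \<psi> k * \<phi> k)"
  unfolding cubic_char_def
proof (intro conjI allI impI)
  show "\<psi> (k * l) * \<phi> (k * l) = \<psi> k * \<phi> k * (\<psi> l * \<phi> l)" for k l
    using assms(3,4) by (simp add: cubic_char_def mult_ac)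
  show "\<exists>e. \<psi> k * \<phi> k = om e" if "coprime k (eis_norm (a * b))" for k
  proof -
    from that have "coprime k (eis_norm a)" "coprime k (eis_norm b)" by (simp_all add: eis_norm_mult)
    then obtain e f where "\<psi> k = om e" "\<phi> k = om f" using assms(3,4) unfolding cubic_char_def by blast
    thus ?thesis using om_add by metis
  qed
  show "\<psi> k * \<phi> k = \<psi> l * \<phi> l" if "a * b dvd of_int (k - l)" for k l
  proof -
    have "a dvd of_int (k - l)" "b dvd of_int (k - l)"
      using that dvd_mult_left dvd_mult_right by blast+
    thus ?thesis using assms(3,4) unfolding cubic_char_def by metis
  qed
  show "csym (a * b) r (\<psi> (int r) * \<phi> (int r))"
    if "prime r \<and> r \<noteq> 3 \<and> \<not> int r dvd eis_norm (a * b)" for r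
    using that assms(3,4) by (intro csym_mult) (auto simp: cubic_char_def eis_norm_mult)
  show "\<psi> 3 * \<phi> 3 = om (eis_re (a * b) * eis_om (a * b) div 3)"
  proof -
    from assms(1,2) obtain a' b' where ab': "eis_om a = 3 * a'" "eis_om b = 3 * b'"
      by (auto simp: primary_def elim!: dvdE)
    obtain u v where uv: "eis_re a * eis_re a = 3 * u + 1" "eis_re b * eis_re b = 3 * v + 1"
      using square_eq_3_mult_plus_1 assms(1,2) unfolding primary_def by metis
    let ?x = "eis_re a" and ?y = "eis_re b"
    have "eis_re (a * b) * eis_om (a * b) = 3 * ((?x * ?y - 9 * a' * b') * (?x * b' + a' * ?y - 3 * a' * b'))"
      by (simp add: ab' algebra_simps)
    hence "eis_re (a * b) * eis_om (a * b) div 3 = (?x * ?y - 9 * a' * b') * (?x * b' + a' * ?y - 3 * a' * b')"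
      by simp
    \<comment> \<open>Squares of the two real coordinates are 1 modulo 3, so the exponent in the
      supplementary law is additive on primary numbers.\<close>
    also have "\<dots> = (?x * ?x) * ?y * b' + (?y * ?y) * ?x * a'
        + 3 * (- ?x * ?y * a' * b' - 3 * a' * b' * (?x * b' + a' * ?y - 3 * a' * b'))"
      by (simp add: algebra_simps)
    also have "[\<dots> = ?y * b' + ?x * a'] (mod 3)"
      unfolding uv cong_iff_dvd_diff by (simp add: algebra_simps)
    finally have "om (eis_re (a * b) * eis_om (a * b) div 3) = om (?x * a' + ?y * b')"
      by (intro om_cong) (simp add: add.commute)
    moreover have "?x * eis_om a div 3 = ?x * a'" "?y * eis_om b div 3 = ?y * b'"
      by (simp_all add: ab')
    ultimately show ?thesis using assms(3,4) unfolding cubic_char_def by (simp only: om_add)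
  qed
qed

lemma (in cubic_prime) primary_jacobi_sum: "primary jacobi_sum"
  using jacobi_sum_primary unfolding primary_def by presburger

lemma (in cubic_prime) cubic_char_chi: "cubic_char jacobi_sum chi"
  unfolding cubic_char_def eis_norm_jacobi_sum
proof (intro conjI allI impI)
  show "chi (k * l) = chi k * chi l" for k l by (rule chi_mult)
  show "\<exists>e. chi t = om e" if "coprime t (int q)" for t
  proof (rule chi_om, rule notI)
    assume "int q dvd t"
    thus False using that q_pos by (auto simp: coprime_absorb_right)
  qed
  show "chi s = chi t" if st: "jacobi_sum dvd of_int (s - t)" for s t
  proof (rule chi_cong)
    obtain w where "of_int (s - t) = jacobi_sum * w" using st by (elim dvdE)
    hence "(s - t) ^ 2 = int q * eis_norm w"
      by (metis eis_norm_mult eis_norm_simps(1) eis_norm_jacobi_sum)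
    hence "int q dvd (s - t) ^ 2" by simp
    thus "[s = t] (mod int q)" using q_int prime_dvd_power cong_iff_dvd_diff by blast
  qed
  show "csym jacobi_sum r (chi (int r))" if "prime r \<and> r \<noteq> 3 \<and> \<not> int r dvd int q" for r
    using that by (intro cubic_reciprocity_rational) auto
  show "chi 3 = om (eis_re jacobi_sum * eis_om jacobi_sum div 3)" by (rule chi_3)
qed

text \<open>The assumption puts a into the prime given by c. Its product with the conjugate of J is
  then divisible by q, which is J times that conjugate, and the conjugate cancels.\<close>

lemma (in cubic_prime) jacobi_sum_dvd:
  assumes "int q dvd eis_re a + eis_om a * c" shows "jacobi_sum dvd a"
proof -
  let ?J = jacobi_sum
  obtain u v where u: "eis_re a + eis_om a * c = int q * u"
    and v: "eis_re ?J + eis_om ?J * c = int q * v"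
    using assms jacobi_sum_root by (auto elim!: dvdE)
  hence re: "eis_re a = int q * u - eis_om a * c" "eis_re ?J = int q * v - eis_om ?J * c" by auto
  have "int q dvd eis_re (a * eis_cnj ?J)"
  proof -
    have "eis_re (a * eis_cnj ?J) = int q * (u * int q * v - u * eis_om ?J * c - u * eis_om ?J - eis_om a * c * v)
        + eis_om a * eis_om ?J * (c\<^sup>2 + c + 1)"
      by (simp add: re algebra_simps power2_eq_square)
    thus ?thesis using c by (metis dvd_add dvd_mult dvd_triv_left)
  qed
  moreover have "int q dvd eis_om (a * eis_cnj ?J)"
  proof -
    have "eis_om (a * eis_cnj ?J) = int q * (eis_om a * v - u * eis_om ?J)"
      by (simp add: re algebra_simps)
    thus ?thesis by simp
  qed
  ultimately have "of_nat q dvd a * eis_cnj ?J" using eis_of_nat_dvd_iff by blast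
  hence "?J * eis_cnj ?J dvd a * eis_cnj ?J" by (simp add: jacobi_sum_mult_cnj)
  moreover have "eis_cnj ?J \<noteq> 0" using jacobi_sum_not_0 by (metis eis_cnj_simps(3,5))
  ultimately show ?thesis by simp
qed

text \<open>By Frobenius a^(r + 1) is the norm modulo r, hence 0. Applied twice, Frobenius gives
  a^(r^2) = a modulo r, and r^2 exceeds r.\<close>

lemma inert_dvd:
  assumes "prime r" "r mod 3 = 2" "int r dvd eis_norm a" shows "of_nat r dvd a"
proof -
  have "dcong (of_nat r) (a ^ r) (eis_cnj a)" by (rule eis_frobenius_2) fact+
  hence 1: "dcong (of_nat r) (a * a ^ r) (a * eis_cnj a)" by (intro dcong_mult) auto
  have "of_nat r dvd a * eis_cnj a"
    using assms(3) by (simp add: eis_mult_cnj eis_of_nat_dvd_iff)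
  hence "of_nat r dvd a * a ^ r" using 1 unfolding dcong_def by (metis dvd_add diff_add_cancel)
  moreover have "Suc r \<le> r * r"
    using prime_ge_2_nat[OF assms(1)] mult_le_mono1[of 2 r r] by linarith
  hence "a * a ^ r dvd a ^ (r * r)" using le_imp_power_dvd[of "Suc r" "r * r" a] by simp
  ultimately have 2: "of_nat r dvd a ^ (r * r)" by (rule dvd_trans)
  have "dcong (of_nat r) ((a ^ r) ^ r) (eis_cnj a ^ r)"
    by (intro dcong_power eis_frobenius_2) fact+
  also have "dcong (of_nat r) (eis_cnj a ^ r) (eis_cnj (eis_cnj a))" by (rule eis_frobenius_2) fact+
  finally have "dcong (of_nat r) (a ^ (r * r)) a" by (simp add: power_mult)
  thus ?thesis using 2 unfolding dcong_def by (metis dvd_diffD1 dvd_minus_iff minus_diff_eq dvd_add diff_add_cancel)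
qed

text \<open>The root c names a prime above r that contains a. If r does not divide the
  \<omega>-coordinate, solving for c gives minus the quotient of the coordinates, and divisibility
  of the norm is the quadratic equation for c.\<close>

lemma split_root:
  assumes r: "prime r" "r = 3 * k + 1" "int r dvd eis_norm a"
  shows "\<exists>c. cubic_prime r k c \<and> int r dvd eis_re a + eis_om a * c"
proof (cases "int r dvd eis_om a")
  case True
  have pr: "prime (int r)" using r(1) by simp
  have "eis_re a * eis_re a = eis_norm a - eis_om a * (eis_om a - eis_re a)"
    by (simp add: eis_norm_def power2_eq_square algebra_simps)
  hence "int r dvd eis_re a * eis_re a" using r(3) True by simp
  hence "int r dvd eis_re a" using pr by (simp add: prime_dvd_mult_iff)
  \<comment> \<open>Here r divides a, so any root of X^2 + X + 1 serves; g^k is one, being a cube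
    root of unity other than 1 modulo r.\<close>
  moreover have "k > 0" using r by (cases k) auto
  then obtain g where g: "coprime g (int r)" "\<not> [g ^ k = 1] (mod int r)"
    using exists_primitive_power[OF r(1), of k] r(2) by auto
  have "int r dvd g ^ r - g" using int_fermat[OF r(1)] by (simp add: dcong_def)
  hence "int r dvd g * ((g ^ k - 1) * ((g ^ k)\<^sup>2 + g ^ k + 1))"
    by (simp add: r(2) algebra_simps power2_eq_square power_add power_mult power3_eq_cube flip: power_mult)
       (simp add: algebra_simps power2_eq_square power3_eq_cube power_mult power_mult_distrib
          mult.commute[of 3 k])
  moreover have "\<not> int r dvd g" using g(1) prime_gt_1_nat[OF r(1)] by (auto simp: coprime_absorb_right)
  moreover have "\<not> int r dvd g ^ k - 1" using g(2) by (simp add: cong_iff_dvd_diff)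
  ultimately have "int r dvd (g ^ k)\<^sup>2 + g ^ k + 1" using pr by (simp add: prime_dvd_mult_iff)
  hence "cubic_prime r k (g ^ k)" using r by unfold_locales
  thus ?thesis using True \<open>int r dvd eis_re a\<close> by auto
next
  case False
  have pr: "prime (int r)" using r(1) by simp
  hence "coprime (eis_om a) (int r)" using False prime_imp_coprime coprime_commute by blast
  then obtain b where b: "[eis_om a * b = 1] (mod int r)" using cong_solve_coprime_int by blast
  define c where "c = - eis_re a * b"
  obtain u where "eis_om a * b - 1 = int r * u"
    using b unfolding cong_iff_dvd_diff by (elim dvdE)
  hence u: "eis_om a * b = 1 + int r * u" by simp
  have "eis_om a ^ 2 * (c\<^sup>2 + c + 1) = eis_re a ^ 2 * (eis_om a * b) ^ 2
      - eis_om a * eis_re a * (eis_om a * b) + eis_om a ^ 2"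
    by (simp add: c_def power2_eq_square algebra_simps)
  also have "\<dots> = eis_norm a + int r * (eis_re a ^ 2 * (2 * u + int r * u ^ 2) - eis_om a * eis_re a * u)"
    unfolding u by (simp add: eis_norm_def power2_eq_square algebra_simps)
  finally have "int r dvd eis_om a ^ 2 * (c\<^sup>2 + c + 1)" using r(3) by simp
  hence "int r dvd c\<^sup>2 + c + 1" using pr False by (simp add: prime_dvd_mult_iff prime_dvd_power_iff)
  hence "cubic_prime r k c" using r by unfold_locales
  moreover have "eis_re a + eis_om a * c = int r * (- eis_re a * u)"
  proof -
    have "eis_re a + eis_om a * c = eis_re a - eis_re a * (eis_om a * b)" by (simp add: c_def algebra_simps)
    thus ?thesis unfolding u by (simp add: algebra_simps)
  qed
  ultimately show ?thesis by auto
qed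

text \<open>Each prime r dividing the norm yields a primary factor with a known character: r itself
  if inert, a Jacobi sum if split. Since 3 cannot divide the norm of a primary number, descent on
  the norm ends at units.\<close>

theorem exists_cubic_char:
  assumes "primary a" shows "\<exists>\<psi>. cubic_char a \<psi>"
  using assms
proof (induction "nat (eis_norm a)" arbitrary: a rule: less_induct)
  case less
  have a0: "a \<noteq> 0" using less.prems by (auto simp: primary_def)
  hence np: "eis_norm a > 0" using eis_norm_nonneg[of a] by (simp add: less_le)
  have step: "\<exists>\<psi>. cubic_char a \<psi>" if b: "b dvd a" "primary b" "cubic_char b \<phi>" "eis_norm b > 1" for b \<phi>
  proof -
    obtain a' where a': "a = b * a'" using b(1) by (elim dvdE)
    have "eis_norm a' > 0" using np eis_norm_nonneg[of a'] b(4)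
      by (auto simp: a' eis_norm_mult zero_less_mult_iff)
    hence "eis_norm a' < eis_norm a" using b(4) by (simp add: a' eis_norm_mult)
    moreover have "primary a'" using b(2) less.prems a' primary_mult_right by blast
    ultimately obtain \<psi> where "cubic_char a' \<psi>" using less.hyps[of a'] np by auto
    thus ?thesis using cubic_char_mult[OF b(2) \<open>primary a'\<close> b(3)] a' by blast
  qed
  show ?case
  proof (cases "eis_norm a = 1")
    case True
    \<comment> \<open>The only primary units are 1 and -1, and these are rational.\<close>
    have "(2 * eis_re a - eis_om a)\<^sup>2 + 3 * (eis_om a)\<^sup>2 = 4" using four_eis_norm[of a] True by simp
    hence "3 * (eis_om a)\<^sup>2 \<le> 4" using zero_le_power2[of "2 * eis_re a - eis_om a"] by linarith
    hence "(eis_om a)\<^sup>2 < 2\<^sup>2" by simp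
    hence "\<bar>eis_om a\<bar> < 2" using power2_less_imp_less[of "\<bar>eis_om a\<bar>" 2] by simp
    hence "eis_om a = 0" using less.prems unfolding primary_def by presburger
    hence "a = of_int (eis_re a)" by (simp add: eis_eq_iff)
    thus ?thesis using cubic_char_of_int by metis
  next
    case False
    have "nat (eis_norm a) \<noteq> 1" using False np by linarith
    then obtain r where r: "prime r" "r dvd nat (eis_norm a)" using prime_factor_nat by blast
    have r': "int r dvd eis_norm a" using r(2) np by (simp flip: int_dvd_int_iff)
    have "r \<noteq> 3"
    proof
      assume "r = 3"
      obtain z where "eis_om a = 3 * z" using less.prems by (auto simp: primary_def elim!: dvdE)
      hence "eis_re a * eis_re a = eis_norm a - 3 * (z * (3 * z - eis_re a))"
        by (simp add: eis_norm_def power2_eq_square algebra_simps)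
      moreover have "3 dvd eis_norm a - 3 * (z * (3 * z - eis_re a))" using r' \<open>r = 3\<close> by simp
      ultimately have "3 dvd eis_re a * eis_re a" by simp
      thus False using less.prems by (simp add: primary_def prime_dvd_mult_iff)
    qed
    from prime_mod_3[OF r(1) this] show ?thesis
    proof
      assume "r mod 3 = 2"
      have "primary (of_int (int r))" unfolding primary_def using \<open>r mod 3 = 2\<close> by simp presburger
      moreover have "of_int (int r) dvd a" using inert_dvd[OF r(1) \<open>r mod 3 = 2\<close> r'] by simp
      moreover have "eis_norm (of_int (int r)) > 1"
        using prime_gt_1_nat[OF r(1)] by (simp add: one_less_power)
      ultimately show ?thesis using step cubic_char_of_int by blast
    next
      assume "r mod 3 = 1"
      define k where "k = r div 3"
      have rk: "r = 3 * k + 1" using \<open>r mod 3 = 1\<close> k_def by presburger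
      obtain c where rc: "cubic_prime r k c" "int r dvd eis_re a + eis_om a * c"
        using split_root[OF r(1) rk r'] by blast
      interpret cubic_prime r k c by (rule rc(1))
      show ?thesis using step[OF jacobi_sum_dvd[OF rc(2)] primary_jacobi_sum cubic_char_chi] q_pos
        by (simp add: eis_norm_jacobi_sum)
    qed
  qed
qed

lemma Legendre_3: "Legendre a 3 = (if a mod 3 = 0 then 0 else if a mod 3 = 1 then 1 else -1)"
proof -
  have *: "QuadRes 3 a \<longleftrightarrow> a mod 3 = 0 \<or> a mod 3 = 1"
  proof
    assume "QuadRes 3 a"
    then obtain z where z: "z\<^sup>2 mod 3 = a mod 3" by (auto simp: QuadRes_def cong_def)
    have "z mod 3 = 0 \<or> z mod 3 = 1 \<or> z mod 3 = 2" by presburger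
    hence "(z mod 3)\<^sup>2 mod 3 = 0 \<or> (z mod 3)\<^sup>2 mod 3 = 1" by auto
    thus "a mod 3 = 0 \<or> a mod 3 = 1" using z by (simp add: power_mod)
  next
    assume "a mod 3 = 0 \<or> a mod 3 = 1"
    thus "QuadRes 3 a" unfolding QuadRes_def cong_def
      by (elim disjE) (auto intro: exI[of _ 0] exI[of _ 1])
  qed
  thus ?thesis by (auto simp: Legendre_def cong_def)
qed

section \<open>Binet's formula and the Lucas sequence modulo p\<close>

definition sqrt_m3 :: eis where "sqrt_m3 = 1 + 2 * omega"

lemma sqrt_m3_simps [simp]: "eis_re sqrt_m3 = 1" "eis_om sqrt_m3 = 2" "eis_cnj sqrt_m3 = - sqrt_m3"
  by (simp_all add: sqrt_m3_def eis_eq_iff)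

text \<open>Binet's formula with denominators cleared: modulo p the quotients of b and of -
  \<open>eis_cnj b\<close> by D have sum m and product -1.\<close>

lemma lucas_U_dcong:
  fixes b D :: eis
  assumes "b - eis_cnj b = D * of_int m" "dcong (of_nat p) (b * eis_cnj b) (D * D)"
  shows "dcong (of_nat p) (D ^ k * of_int (lucas_U m (-1) k) * (b + eis_cnj b)) (D * (b ^ k - (- eis_cnj b) ^ k))"
proof (induction k rule: induct_nat_012)
  case 1
  show ?case by simp
next
  case (ge2 k)
  let ?U = "\<lambda>k. of_int (lucas_U m (-1) k) :: eis"
  define g where "g = - eis_cnj b"
  define E where "E = b + eis_cnj b"
  have sum: "D * of_int m = b + g" using assms(1) by (simp add: g_def)
  have prod: "dcong (of_nat p) (D * D) (- (b * g))" using dcong_sym[OF assms(2)] by (simp add: g_def)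
  have "D ^ Suc (Suc k) * ?U (Suc (Suc k)) * E
      = (D * of_int m) * (D ^ Suc k * ?U (Suc k) * E) + (D * D) * (D ^ k * ?U k * E)"
    by (simp add: algebra_simps)
  also have "dcong (of_nat p) \<dots> ((b + g) * (D * (b ^ Suc k - g ^ Suc k)) + (- (b * g)) * (D * (b ^ k - g ^ k)))"
    unfolding sum E_def g_def
    by (rule dcong_add[OF dcong_mult[OF dcong_refl ge2(2)] dcong_mult[OF prod[unfolded g_def] ge2(1)]])
  also have "(b + g) * (D * (b ^ Suc k - g ^ Suc k)) + (- (b * g)) * (D * (b ^ k - g ^ k))
      = D * (b ^ Suc (Suc k) - g ^ Suc (Suc k))"
    by (simp add: algebra_simps)
  finally show ?case unfolding E_def g_def .
qed simp

lemma eis_norm_om [simp]: "eis_norm (om e) = 1"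
  using om_cases[of e] by (auto simp: eis_norm_def)

locale lucas_setup =
  fixes d m n x y :: int and p k :: nat
  assumes d: "d > 1" and mn: "m\<^sup>2 - d * n\<^sup>2 = -4" and n0: "n \<noteq> 0"
    and p: "prime p" and pn: "\<not> int p dvd n"
    and pxy: "int p = x\<^sup>2 + 3 * d * y\<^sup>2" and y3: "\<not> 3 dvd y" and xy: "[x = y] (mod 3)"
    and p_eq: "p = 3 * k + 1"
begin

lemma prime_p: "prime (int p)" using p by simp

lemma x3: "\<not> 3 dvd x" using xy y3 by (simp add: cong_dvd_iff)

lemma coprime_dny: "coprime (d * n * y) (int p)"
  using coprime_denominator d p pn pxy y3 by blast

lemma p_not_dvd: "\<not> int p dvd d" "\<not> int p dvd y"
  using coprime_dny prime_gt_1_nat[OF p] by (auto simp: coprime_absorb_right)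

lemma p_gt_5: "p > 5"
proof -
  have "y \<noteq> 0" using y3 by auto
  hence "y\<^sup>2 \<ge> 1" by (simp add: int_one_le_iff_zero_less)
  hence "d * y\<^sup>2 \<ge> 2 * 1" using d by (intro mult_mono) auto
  moreover have "x\<^sup>2 \<ge> 0" by simp
  ultimately have "int p \<ge> 6" unfolding pxy mult.assoc by linarith
  thus ?thesis by simp
qed

lemma even_k: "even k"
proof -
  have "odd p" using p p_gt_5 prime_odd_nat by auto
  thus ?thesis using p_eq by presburger
qed

lemma p_not_dvd_numeral: "\<not> int p dvd 2" "\<not> int p dvd 3"
  using p_gt_5 zdvd_not_zless[of 2 "int p"] zdvd_not_zless[of 3 "int p"] by auto

lemma p_not_dvd_x: "\<not> int p dvd x"
proof
  assume "int p dvd x"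
  hence "int p dvd int p - x * x" by simp
  also have "int p - x * x = 3 * (d * (y * y))" using pxy by (simp add: power2_eq_square)
  finally show False using p_not_dvd_numeral p_not_dvd p by (simp add: prime_dvd_mult_iff)
qed

definition \<beta> :: eis where "\<beta> = of_int (n * x) + of_int (m * y) * sqrt_m3"

lemma norm_\<beta>: "eis_norm \<beta> = n\<^sup>2 * int p - 12 * y\<^sup>2"
proof -
  have "eis_norm \<beta> = n\<^sup>2 * x\<^sup>2 + 3 * y\<^sup>2 * m\<^sup>2"
    by (simp add: \<beta>_def eis_norm_def power2_eq_square algebra_simps)
  also have "m\<^sup>2 = d * n\<^sup>2 - 4" using mn by simp
  finally show ?thesis by (simp add: pxy algebra_simps)
qed

text \<open>Modulo p the product of \<beta> and its conjugate is D^2, and the 3k-th powers of the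
  conjugate and of D are 1; so the k-th power of the conjugate is \<omega>^i D^k. Binet's formula
  then equates U n x with y sqrt(-3) (\<omega>^i - 1) \<omega>^i, which is one of 0, 3 y, -3
  y.\<close>

lemma lucas_U_of_symbol:
  assumes "csym \<beta> p (om i)"
  shows "[lucas_U m (-1) k = (if i mod 3 = 0 then 0 else if i mod 3 = 1 then -1 else 1)
    * (x * modular_inverse (int p) (d * n * y))] (mod int p)"
proof -
  let ?U = "lucas_U m (-1) k"
  let ?b = "eis_cnj \<beta>"
  define D where "D = of_int (2 * y) * sqrt_m3"
  have DD: "D * D = of_int (- 12 * y\<^sup>2)"
    by (simp add: D_def eis_eq_iff power2_eq_square)
  have np12: "\<not> int p dvd - 12 * y\<^sup>2"
  proof
    assume "int p dvd - 12 * y\<^sup>2"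
    hence "int p dvd 2 * (2 * (3 * (y * y)))" by (simp add: power2_eq_square)
    thus False using p p_not_dvd_numeral p_not_dvd by (simp only: prime_dvd_mult_iff prime_p) simp
  qed
  have np\<beta>: "\<not> int p dvd eis_norm \<beta>"
  proof
    assume "int p dvd eis_norm \<beta>"
    hence "int p dvd eis_norm \<beta> - n\<^sup>2 * int p" by simp
    thus False using np12 by (simp add: norm_\<beta>)
  qed
  have sub: "\<beta> - ?b = D * of_int m" and add: "\<beta> + ?b = of_int (2 * n * x)"
    by (simp_all add: \<beta>_def D_def eis_eq_iff algebra_simps)
  have prod: "dcong (of_nat p) (\<beta> * ?b) (D * D)"
    by (simp add: dcong_def DD eis_mult_cnj norm_\<beta> eis_of_nat_dvd_iff)
  have k3: "(p - 1) div 3 = k" "p mod 3 = 1" using p_eq by (simp, presburger)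
  have sym: "dcong (of_nat p) (\<beta> ^ k) (om i * ?b ^ k)"
    using assms k3 by (simp add: csym_def)
  have "dcong (of_nat p) (om i * ?b ^ k * ?b ^ k) (\<beta> ^ k * ?b ^ k)"
    by (rule dcong_mult[OF dcong_sym[OF sym] dcong_refl])
  also have "dcong (of_nat p) (\<beta> ^ k * ?b ^ k) (D ^ (2 * k))"
    using dcong_power[OF prod, of k] by (simp add: power_mult_distrib power_mult power2_eq_square)
  finally have "dcong (of_nat p) (om i * ?b ^ k * ?b ^ k * ?b ^ k) (D ^ (2 * k) * ?b ^ k)"
    by (rule dcong_mult[OF _ dcong_refl])
  moreover have "om i * ?b ^ k * ?b ^ k * ?b ^ k = om i * ?b ^ (3 * k)"
  proof -
    have "3 * k = k + (k + k)" by simp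
    thus ?thesis by (simp only: power_add mult.assoc)
  qed
  moreover have "dcong (of_nat p) (om i * ?b ^ (3 * k)) (om i * D ^ (3 * k))"
  proof (rule dcong_mult[OF dcong_refl])
    have "\<not> int p dvd eis_norm D"
    proof
      assume "int p dvd eis_norm D"
      moreover have "eis_norm D = 12 * y\<^sup>2"
        by (simp add: D_def eis_norm_def power2_eq_square)
      ultimately show False using np12 by simp
    qed
    thus "dcong (of_nat p) (?b ^ (3 * k)) (D ^ (3 * k))"
      using eis_fermat[OF p p_eq, of D] eis_fermat[OF p p_eq, of ?b] np\<beta>
        dcong_trans[OF _ dcong_sym] by simp
  qed
  ultimately have "dcong (of_nat p) (om i * D ^ (3 * k)) (D ^ (2 * k) * ?b ^ k)"
    using dcong_trans[OF dcong_sym] by simp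
  moreover have "om i * D ^ (3 * k) = D ^ (2 * k) * (om i * D ^ k)"
    by (simp add: mult_ac flip: power_add)
  moreover have "D ^ (2 * k) = of_int ((- 12 * y\<^sup>2) ^ k)"
    using DD by (simp add: power_mult power2_eq_square)
  ultimately have "of_nat p dvd of_int ((- 12 * y\<^sup>2) ^ k) * (om i * D ^ k - ?b ^ k)"
    by (simp add: dcong_def right_diff_distrib)
  moreover have npk: "\<not> int p dvd (- 12 * y\<^sup>2) ^ j" for j
    using np12 prime_p prime_dvd_power by blast
  ultimately have bk: "dcong (of_nat p) (om i * D ^ k) (?b ^ k)"
    using eis_dvd_of_int_cancel p unfolding dcong_def by blast
  have "dcong (of_nat p) (D ^ k * of_int ?U * (\<beta> + ?b)) (D * (\<beta> ^ k - (- ?b) ^ k))"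
    by (rule lucas_U_dcong[OF sub prod])
  also have "(- ?b) ^ k = ?b ^ k" using even_k by simp
  also have "dcong (of_nat p) (D * (\<beta> ^ k - ?b ^ k)) (D * (om i * ?b ^ k - ?b ^ k))"
    by (intro dcong_mult[OF dcong_refl] dcong_diff sym dcong_refl)
  also have "D * (om i * ?b ^ k - ?b ^ k) = D * (om i - 1) * ?b ^ k" by (simp add: algebra_simps)
  also have "dcong (of_nat p) \<dots> (D * (om i - 1) * (om i * D ^ k))"
    by (rule dcong_mult[OF dcong_refl dcong_sym[OF bk]])
  finally have "of_nat p dvd D ^ k * (of_int ?U * (\<beta> + ?b) - D * (om i - 1) * om i)"
    by (simp add: dcong_def algebra_simps)
  moreover have "D ^ k = of_int ((- 12 * y\<^sup>2) ^ (k div 2))"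
  proof -
    have "D ^ k = (D * D) ^ (k div 2)" using even_k by (simp flip: power2_eq_square power_mult)
    thus ?thesis by (simp add: DD)
  qed
  ultimately have "of_nat p dvd of_int ?U * (\<beta> + ?b) - D * (om i - 1) * om i"
    using eis_dvd_of_int_cancel p npk by metis
  also have "of_int ?U * (\<beta> + ?b) - D * (om i - 1) * om i
      = of_int 2 * (of_int (?U * n * x) - of_int y * (sqrt_m3 * (om i - 1) * om i))"
    by (simp add: add D_def algebra_simps)
  finally have "of_nat p dvd of_int (?U * n * x) - of_int y * (sqrt_m3 * (om i - 1) * om i)"
    using eis_dvd_of_int_cancel p p_not_dvd_numeral(1) by blast
  moreover define e :: int where "e = (if i mod 3 = 0 then 0 else if i mod 3 = 1 then -1 else 1)"
  moreover have "sqrt_m3 * (om i - 1) * om i = of_int (- 3 * e)"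
    using om_cases[of i] by (auto simp: e_def eis_eq_iff)
  ultimately have "of_nat p dvd (of_int (?U * n * x) - of_int y * of_int (- 3 * e) :: eis)"
    by (simp only:)
  also have "of_int (?U * n * x) - of_int y * of_int (- 3 * e) = (of_int (?U * n * x + 3 * e * y) :: eis)"
    by (simp add: mult_ac)
  finally have "of_nat p dvd (of_int (?U * n * x + 3 * e * y) :: eis)" .
  hence "int p dvd ?U * n * x + 3 * e * y" unfolding eis_of_nat_dvd_iff by simp
  \<comment> \<open>Replacing 3 d y^2 by p - x^2 frees a factor x and produces the denominator d n
    y.\<close>
  hence "int p dvd (?U * n * x + 3 * e * y) * (d * y) - e * int p" by simp
  also have "(?U * n * x + 3 * e * y) * (d * y) - e * int p = x * (?U * (d * n * y) - e * x)"
    by (simp add: pxy power2_eq_square algebra_simps)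
  finally have "int p dvd ?U * (d * n * y) - e * x"
    using p_not_dvd_x prime_p prime_dvd_mult_iff by blast
  hence 1: "[?U * (d * n * y) = e * x] (mod int p)" by (simp add: cong_iff_dvd_diff)
  let ?v = "modular_inverse (int p) (d * n * y)"
  have inv: "[d * n * y * ?v = 1] (mod int p)" using coprime_dny by (rule cong_modular_inverse1)
  have "[?U * 1 = ?U * (d * n * y * ?v)] (mod int p)" by (intro cong_mult cong_sym[OF inv]) simp
  also have "?U * (d * n * y * ?v) = ?U * (d * n * y) * ?v" by (simp add: mult_ac)
  also have "[\<dots> = e * x * ?v] (mod int p)" by (intro cong_mult 1) simp
  finally show ?thesis by (simp add: e_def mult.assoc)
qed

section \<open>Removing the common factor of n and 2 y from \<beta>\<close>

definition g :: int where "g = gcd n (2 * y)"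
definition n1 :: int where "n1 = n div g"
definition s :: int where "s = 2 * y div g"
definition B :: int where "B = m * s div 2"
definition A :: int where "A = n1 * x"
text \<open>This is \<beta> divided by g. Its norm n1^2 p - 3 s^2 is prime to n1, s and p, so a
  character modulo \<alpha> takes roots of unity as values there.\<close>

definition \<alpha> :: eis where "\<alpha> = of_int A + of_int B * sqrt_m3"

lemma n_eq: "n = g * n1" and y_eq: "2 * y = g * s"
  by (simp_all add: n1_def s_def g_def)

lemma coprime_n1_s: "coprime n1 s"
  unfolding n1_def s_def g_def using n0 by (intro div_gcd_coprime) auto

lemma n_s: "n * s = 2 * y * n1"
proof -
  have "n * s = n1 * (g * s)" using arg_cong[OF n_eq, of "\<lambda>z. z * s"] by (simp only: mult_ac)
  also have "g * s = 2 * y" by (rule y_eq[symmetric])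
  finally show ?thesis by (simp only: mult_ac)
qed

text \<open>The halving in \<open>B\<close> is exact: for odd m the norm equation makes n odd, hence
  g odd, and 2 y = g s makes s even.\<close>

lemma m_s: "m * s = 2 * B"
proof (cases "even m")
  case False
  have "d * n\<^sup>2 = m\<^sup>2 + 4" using mn by simp
  hence "odd n" using False by (metis even_add even_mult_iff even_numeral even_power zero_less_numeral)
  hence "odd g" using n_eq by (metis even_mult_iff)
  hence "even s" using y_eq by (metis dvd_triv_left even_mult_iff)
  thus ?thesis by (simp add: B_def)
qed (simp add: B_def)

lemma \<beta>_eq: "\<beta> = of_int g * \<alpha>"
proof -
  have "2 * (m * y) = m * (2 * y)" by simp
  also have "\<dots> = g * (m * s)" by (subst y_eq) (simp add: mult_ac)
  also have "\<dots> = 2 * (g * B)" by (simp add: m_s)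
  finally have "m * y = g * B" by simp
  moreover have "n * x = g * A"
    using arg_cong[OF n_eq, of "\<lambda>z. z * x"] by (simp add: A_def mult_ac)
  ultimately show ?thesis by (simp add: \<beta>_def \<alpha>_def algebra_simps)
qed

lemma n3: "\<not> 3 dvd n"
proof
  assume "3 dvd n"
  then obtain z where "n = 3 * z" by (elim dvdE)
  moreover define X where "X = 3 * d * z\<^sup>2 - 2"
  ultimately have "m\<^sup>2 = 3 * X + 2" using mn by (simp add: power2_eq_square algebra_simps)
  hence "m\<^sup>2 mod 3 = 2" by simp
  moreover have "m mod 3 = 0 \<or> m mod 3 = 1 \<or> m mod 3 = 2" by presburger
  hence "(m mod 3)\<^sup>2 mod 3 = 0 \<or> (m mod 3)\<^sup>2 mod 3 = 1" by auto
  ultimately show False by (simp add: power_mod)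
qed

lemma n1_3: "\<not> 3 dvd n1"
  using n3 n_eq dvd_mult[of 3 n1 g] by metis

lemma s_3: "\<not> 3 dvd s"
proof
  assume "3 dvd s"
  hence "3 dvd 2 * y" by (simp add: y_eq)
  thus False using y3 by presburger
qed

lemma A_3: "\<not> 3 dvd A"
  using n1_3 x3 by (simp add: A_def prime_dvd_mult_iff)

lemma norm_\<alpha>: "eis_norm \<alpha> = A * A + 3 * (B * B)"
  by (simp add: \<alpha>_def eis_norm_def power2_eq_square algebra_simps)

lemma norm_\<alpha>': "eis_norm \<alpha> = n1 * n1 * int p - 3 * (s * s)"
proof -
  have "4 * (B * B) = (m * s) * (m * s)" by (simp add: m_s)
  also have "\<dots> = d * (n * s) * (n * s) - 4 * (s * s)"
  proof -
    have "m * m = d * n * n - 4" using mn by (simp add: power2_eq_square)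
    hence "(m * m) * (s * s) = (d * n * n - 4) * (s * s)" by simp
    thus ?thesis by (simp add: algebra_simps)
  qed
  finally have "B * B = d * (y * n1) * (y * n1) - s * s" unfolding n_s by (simp add: algebra_simps)
  thus ?thesis by (simp add: norm_\<alpha> A_def pxy power2_eq_square algebra_simps)
qed

lemma p_not_dvd_s: "\<not> int p dvd s"
proof
  assume "int p dvd s"
  hence "int p dvd 2 * y" by (simp add: y_eq)
  thus False using p_not_dvd_numeral p_not_dvd prime_p prime_dvd_mult_iff by blast
qed

lemma coprime_norm: "coprime n1 (eis_norm \<alpha>)" "coprime s (eis_norm \<alpha>)" "coprime (int p) (eis_norm \<alpha>)"
proof -
  have c3: "coprime 3 z" if "\<not> 3 dvd z" for z :: int
    using that by (intro prime_imp_coprime) auto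
  have cp: "coprime (int p) z" if "\<not> int p dvd z" for z :: int
    using that prime_p prime_imp_coprime by blast
  have gcd_eq: "gcd z (z * u - v) = gcd z v" "gcd z (v - z * u) = gcd z v" for z u v :: int
    using gcd_add_mult[of z u "- v"] gcd_add_mult[of z "- u" v] by (simp_all add: algebra_simps)
  have "eis_norm \<alpha> = n1 * (n1 * int p) - 3 * (s * s)" using norm_\<alpha>' by (simp add: mult_ac)
  moreover have "coprime n1 (3 * (s * s))"
    using coprime_n1_s c3[OF n1_3] by (simp add: coprime_commute)
  ultimately show "coprime n1 (eis_norm \<alpha>)" by (simp add: coprime_iff_gcd_eq_1 gcd_eq)
  have "eis_norm \<alpha> = n1 * n1 * int p - s * (3 * s)" using norm_\<alpha>' by (simp add: mult_ac)
  moreover have "coprime s (n1 * n1 * int p)"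
    using coprime_n1_s cp[OF p_not_dvd_s] by (simp add: coprime_commute)
  ultimately show "coprime s (eis_norm \<alpha>)" by (simp add: coprime_iff_gcd_eq_1 gcd_eq)
  have "eis_norm \<alpha> = int p * (n1 * n1) - 3 * (s * s)" using norm_\<alpha>' by (simp add: mult_ac)
  moreover have "coprime (int p) (3 * (s * s))"
    using cp[OF p_not_dvd_s] cp[OF p_not_dvd_numeral(2)] by simp
  ultimately show "coprime (int p) (eis_norm \<alpha>)" by (simp add: coprime_iff_gcd_eq_1 gcd_eq)
qed

text \<open>
  The character modulo \<open>\<omega>\<^sup>j \<alpha>\<close> is evaluated at both sides of
  \<open>n1\<^sup>2 p \<equiv> 3 s\<^sup>2 (mod \<alpha>)\<close>; modulo the divisors of \<open>s\<close> and \<open>n1\<close> the number \<open>\<alpha>\<close> is real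
  respectively purely imaginary.
\<close>

lemma symbol_\<alpha>:
  fixes j S U :: int
  assumes "primary (om j * \<alpha>)" and S: "s * s = 3 * S + 1" and U: "n1 * n1 = 3 * U + 1"
  obtains i where "csym \<alpha> p (om i)"
    "[i = eis_re (om j * \<alpha>) * eis_om (om j * \<alpha>) div 3 + j * (2 * S + U + 4 * int k)] (mod 3)"
proof -
  let ?a = "om j * \<alpha>"
  have N: "eis_norm ?a = eis_norm \<alpha>" by (simp add: eis_norm_mult)
  obtain \<psi> where \<psi>: "cubic_char ?a \<psi>" using exists_cubic_char assms(1) by blast
  have mult: "\<psi> (u * v) = \<psi> u * \<psi> v" for u v using \<psi> by (simp add: cubic_char_def)
  have cop: "\<exists>e. \<psi> u = om e" if "coprime u (eis_norm \<alpha>)" for u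
    using \<psi> that N unfolding cubic_char_def by metis
  have unit: "\<psi> 1 = 1"
  proof -
    obtain e where "\<psi> 1 = om e" using cop[of 1] by auto
    hence "\<psi> 1 \<noteq> 0" by simp
    thus ?thesis using mult[of 1 1] by simp
  qed
  have neg: "\<psi> (-1) = 1"
  proof -
    obtain e where "\<psi> (-1) = om e" using cop[of "-1"] by auto
    hence "\<psi> (-1) ^ 3 = 1" by simp
    thus ?thesis using mult[of "-1" "-1"] unit by (simp add: power3_eq_cube)
  qed
  \<comment> \<open>If \<alpha> has trivial symbol at the primes dividing z, only the unit
    \<omega>^j contributes to the value at z.\<close>
  have val: "\<psi> z = om (j * ((z\<^sup>2 - 1) div 3))"
    if z: "\<not> 3 dvd z" "coprime z (eis_norm \<alpha>)"
      and c: "\<And>r. prime r \<Longrightarrow> r \<noteq> 3 \<Longrightarrow> int r dvd z \<Longrightarrow> csym \<alpha> r 1" for z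
  proof (rule multiplicative_eq_om[of \<psi>, OF mult unit neg _ z(1)])
    fix r assume r: "prime r" "int r dvd z"
    have r3: "r \<noteq> 3" using z(1) r(2) by auto
    have cr: "coprime (int r) (eis_norm \<alpha>)" using z(2) r(2) coprime_divisors dvd_refl by blast
    hence nr: "\<not> int r dvd eis_norm \<alpha>" using prime_gt_1_nat[OF r(1)] by (auto simp: coprime_absorb_left)
    obtain e where e: "\<psi> (int r) = om e" using cop cr by blast
    have "csym ?a r (om e)" using \<psi> r(1) r3 nr N e unfolding cubic_char_def by metis
    moreover have "csym ?a r (om (j * ((int r ^ 2 - 1) div 3)))"
      using csym_mult[OF csym_om[OF r(1) r3, of j] c[OF r(1) r3 r(2)]] by simp
    ultimately show "\<psi> (int r) = om (j * ((int r ^ 2 - 1) div 3))"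
      using csym_unique[OF r(1)] nr N e by metis
  qed
  have \<psi>n: "\<psi> n1 = om (j * U)"
  proof -
    have "csym \<alpha> r 1" if r: "prime r" "r \<noteq> 3" "int r dvd n1" for r
    proof (rule csym_imaginary)
      have "int r dvd A" using r(3) by (simp add: A_def)
      thus "dcong (of_nat r) (eis_cnj \<alpha>) (- \<alpha>)"
        by (simp add: dcong_def \<alpha>_def eis_of_nat_dvd_iff)
    qed fact+
    from val[OF n1_3 coprime_norm(1) this] show ?thesis by (simp add: power2_eq_square U)
  qed
  have \<psi>s: "\<psi> s = om (j * S)"
  proof -
    have "csym \<alpha> r 1" if r: "prime r" "r \<noteq> 3" "int r dvd s" for r
    proof (rule csym_real)
      have "int r dvd 2 * B" using r(3) by (simp flip: m_s)
      thus "dcong (of_nat r) \<alpha> (eis_cnj \<alpha>)"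
        using dvd_mult[of "int r" "2 * B" 2] by (simp add: dcong_def \<alpha>_def eis_of_nat_dvd_iff)
    qed
    from val[OF s_3 coprime_norm(2) this] show ?thesis by (simp add: power2_eq_square S)
  qed
  have np: "\<not> int p dvd eis_norm \<alpha>"
    using coprime_norm(3) prime_gt_1_nat[OF p] by (auto simp: coprime_absorb_left)
  have p3: "p \<noteq> 3" using p_gt_5 by simp
  obtain e where e: "\<psi> (int p) = om e" using cop coprime_norm(3) by blast
  have "?a dvd of_int (eis_norm \<alpha>)" using eis_mult_cnj[of ?a] N by (metis dvd_triv_left)
  hence "\<psi> (n1 * n1 * int p) = \<psi> (3 * (s * s))"
    using \<psi> norm_\<alpha>' unfolding cubic_char_def by metis
  moreover define t where "t = eis_re ?a * eis_om ?a div 3"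
  moreover from this have "\<psi> 3 = om t" using \<psi> by (simp only: cubic_char_def)
  ultimately have "om (j * U + j * U + e) = om (t + (j * S + j * S))"
    by (simp only: mult \<psi>n \<psi>s e om_add)
  hence et: "[j * U + j * U + e = t + (j * S + j * S)] (mod 3)" by (simp only: om_eq_iff)
  have "csym ?a p (om e)" using \<psi> p p3 np N e unfolding cubic_char_def by metis
  \<comment> \<open>Multiplying by \<omega>^(2 j) removes the unit again. This costs the symbol of
    \<omega> at p, whose exponent is 2 k modulo 3; hence the term 4 k.\<close>
  with csym_om[OF p p3, of "2 * j"]
  have "csym (om (2 * j) * ?a) p (om (2 * j * ((int p ^ 2 - 1) div 3)) * om e)"
    by (rule csym_mult)
  moreover have "om (2 * j) * ?a = \<alpha>"
  proof -
    have "om (2 * j) * om j = 1" using om_mult_cnj[of j] by (simp add: om_cnj mult.commute)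
    thus ?thesis by (simp flip: mult.assoc)
  qed
  moreover have "(int p ^ 2 - 1) div 3 = 3 * int k * int k + 2 * int k"
    by (simp add: p_eq power2_eq_square algebra_simps)
  ultimately have "csym \<alpha> p (om (2 * j * (3 * int k * int k + 2 * int k) + e))"
    by (simp add: om_add)
  moreover have "[2 * j * (3 * int k * int k + 2 * int k) + e = t + j * (2 * S + U + 4 * int k)] (mod 3)"
  proof -
    obtain w where "j * U + j * U + e - (t + (j * S + j * S)) = 3 * w"
      using et unfolding cong_iff_dvd_diff by (elim dvdE)
    hence "e = 3 * w + t + 2 * (j * S) - 2 * (j * U)" by linarith
    hence "2 * j * (3 * int k * int k + 2 * int k) + e - (t + j * (2 * S + U + 4 * int k))
        = 3 * (2 * j * int k * int k + w - j * U)"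
      by (simp add: algebra_simps)
    thus ?thesis by (simp only: cong_iff_dvd_diff dvd_triv_left)
  qed
  ultimately show ?thesis using that t_def by blast
qed

section \<open>The exponent of the symbol in terms of m and n\<close>

lemma csym_\<beta>: "csym \<alpha> p (om i) \<Longrightarrow> csym \<beta> p (om i)"
  using csym_mult[OF csym_of_int] by (simp add: \<beta>_eq)

text \<open>The normalization x = y modulo 3 enters here and fixes the sign of the final formula. As
  s is 1 or -1 modulo 3, this determines A modulo 3.\<close>

lemma A_s: "[A * s = - n] (mod 3)"
proof -
  obtain S where S: "s * s = 3 * S + 1" using square_eq_3_mult_plus_1[OF s_3] .
  obtain t where "x - y = 3 * t" using xy unfolding cong_iff_dvd_diff by (elim dvdE)
  hence t: "x = y + 3 * t" by simp
  have "4 * (n1 * s * y) = 2 * (n * s) * s" by (simp add: n_s)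
  also have "\<dots> = 2 * n * (3 * S + 1)" by (simp flip: S)
  finally have "n1 * s * y = 6 * n * S + 2 * n - 3 * (n1 * s * y)" by (simp add: algebra_simps)
  moreover have "A * s = n1 * s * y + 3 * (n1 * s * t)" by (simp add: A_def) (simp add: t algebra_simps)
  ultimately have "A * s - (- n) = 3 * (2 * n * S + n - n1 * s * y + n1 * s * t)" by simp
  thus ?thesis by (simp only: cong_iff_dvd_diff dvd_triv_left)
qed

lemma B_s: "[B * s = - m] (mod 3)"
proof -
  obtain S where S: "s * s = 3 * S + 1" using square_eq_3_mult_plus_1[OF s_3] .
  have "2 * B * s = m * (s * s)" by (simp flip: m_s)
  hence *: "2 * (B * s) = 3 * (m * S) + m" by (simp add: S algebra_simps)
  have lin: "Z - (- m) = 3 * (Z - Y)" if "2 * Z = 3 * Y + m" for Y Z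
    using that by presburger
  have "B * s - (- m) = 3 * (B * s - m * S)" by (rule lin[OF *])
  thus ?thesis by (simp only: cong_iff_dvd_diff dvd_triv_left)
qed

text \<open>Here 3 divides B, so \<alpha> is primary as it stands; with j = 0 the supplementary law
  gives the whole exponent.\<close>

lemma symbol_\<beta>_dvd_3:
  assumes m: "m = 3 * m'" obtains i where "csym \<beta> p (om i)" "[i = - (m' * n)] (mod 3)"
proof -
  obtain S U where S: "s * s = 3 * S + 1" and U: "n1 * n1 = 3 * U + 1"
    using square_eq_3_mult_plus_1[OF s_3] square_eq_3_mult_plus_1[OF n1_3] by metis
  have "m * s = 3 * (m' * s)" by (simp add: m)
  hence "2 * B = 3 * (m' * s)" by (simp only: m_s)
  hence "3 dvd B" by presburger
  then obtain B' where B': "B = 3 * B'" by (elim dvdE)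
  have mB: "m' * s = 2 * B'" using \<open>2 * B = 3 * (m' * s)\<close> B' by simp
  have "primary (om 0 * \<alpha>)" using A_3 by (simp add: primary_def \<alpha>_def B') presburger
  then obtain i where i: "csym \<alpha> p (om i)"
    "[i = eis_re (om 0 * \<alpha>) * eis_om (om 0 * \<alpha>) div 3 + 0 * (2 * S + U + 4 * int k)] (mod 3)"
    using symbol_\<alpha> S U by metis
  have "eis_re (om 0 * \<alpha>) * eis_om (om 0 * \<alpha>) = 3 * ((A + 3 * B') * (2 * B'))"
    by (simp add: \<alpha>_def B')
  also have "\<dots> div 3 = (A + 3 * B') * (m' * s)" by (simp add: mB)
  finally have "[i = (A + 3 * B') * (m' * s)] (mod 3)" using i(2) by simp
  also have "[(A + 3 * B') * (m' * s) = A * s * m'] (mod 3)"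
    by (simp add: cong_iff_dvd_diff algebra_simps)
  also have "[A * s * m' = - n * m'] (mod 3)" by (intro cong_mult A_s) simp
  finally show ?thesis by (intro that[of i] csym_\<beta> i(1)) (simp add: mult.commute)
qed

text \<open>Neither A nor B is divisible by 3, and the sign in A = B or A = - B modulo 3 decides
  whether j is 1 or 2. The exponent becomes M + 1 or - (M + 1), the sign agreeing with m n modulo 3;
  the class of m modulo 9 enters through M modulo 3.\<close>

lemma symbol_\<beta>_not_dvd_3:
  assumes M: "m * m = 3 * M + 1" obtains i where "csym \<beta> p (om i)" "[i = m * n * (4 * M + 1)] (mod 3)"
proof -
  obtain S U where S: "s * s = 3 * S + 1" and U: "n1 * n1 = 3 * U + 1"
    using square_eq_3_mult_plus_1[OF s_3] square_eq_3_mult_plus_1[OF n1_3] by metis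
  have "\<not> 3 dvd m"
  proof
    assume "3 dvd m"
    hence "3 dvd m * m" by simp
    thus False using M by presburger
  qed
  have B3: "\<not> 3 dvd B"
  proof
    assume "3 dvd B"
    hence "3 dvd m * s" by (simp add: m_s)
    thus False using \<open>\<not> 3 dvd m\<close> s_3 by (simp add: prime_dvd_mult_iff)
  qed
  obtain T where T: "B * B = 3 * T + 1" using square_eq_3_mult_plus_1[OF B3] .
  have "4 * (B * B) = (m * m) * (s * s)"
  proof -
    have "(2 * B) * (2 * B) = (m * s) * (m * s)" by (simp add: m_s)
    thus ?thesis by (simp add: algebra_simps)
  qed
  hence TMS: "4 * T = 3 * (M * S) + M + S - 1" unfolding T M S by (simp add: algebra_simps)
  \<comment> \<open>The two expressions for the norm of \<alpha>, equated; this relation will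
    eliminate U.\<close>
  have norm: "A * A + 9 * T + 9 * S + 5 = 9 * (int k * U) + 3 * U + 3 * int k"
  proof -
    have "A * A + 3 * (B * B) = n1 * n1 * int p - 3 * (s * s)" using norm_\<alpha> norm_\<alpha>' by simp
    moreover have "int p = 3 * int k + 1" by (simp add: p_eq)
    ultimately show ?thesis by (simp add: T S U algebra_simps)
  qed
  have "A mod 3 \<noteq> 0" "B mod 3 \<noteq> 0" using A_3 B3 by presburger+
  hence "A mod 3 = B mod 3 \<or> (A + B) mod 3 = 0" by presburger
  hence "3 dvd A - B \<or> 3 dvd A + B" by presburger
  then obtain h where "A - B = 3 * h \<or> A + B = 3 * h" by (auto elim!: dvdE)
  hence "A = B + 3 * h \<or> A = - B + 3 * h" by auto
  thus ?thesis
  proof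
    assume A: "A = B + 3 * h"
    have om1: "eis_re (om 1 * \<alpha>) = - 2 * B" "eis_om (om 1 * \<alpha>) = 3 * h"
      by (simp_all add: \<alpha>_def A)
    have "primary (om 1 * \<alpha>)" unfolding primary_def om1 using B3 by presburger
    then obtain i where i: "csym \<alpha> p (om i)"
      "[i = (- 2 * B) * (3 * h) div 3 + 1 * (2 * S + U + 4 * int k)] (mod 3)"
      using symbol_\<alpha>[OF _ S U, of 1] unfolding om1 by metis
    have "(- 2 * B) * (3 * h) = 3 * (- 2 * (B * h))" by simp
    also have "\<dots> div 3 = - 2 * (B * h)" by (rule nonzero_mult_div_cancel_left) simp
    finally have "[i = - 2 * (B * h) + (2 * S + U + 4 * int k)] (mod 3)" using i(2) by simp
    moreover
    have "- 2 * (B * h) + (2 * S + U + 4 * int k) - (M + 1)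
        = 3 * (2 * S + M * S + h * h - int k * U + int k)"
    proof -
      have AA: "A * A = B * B + 6 * (B * h) + 9 * (h * h)" by (simp add: A algebra_simps)
      \<comment> \<open>With the products generalized to variables the claim is linear: the norm
        relation, divided by 3, is solved for U.\<close>
      have lin: "- 2 * H + (2 * S + U + 4 * K) - (M + 1) = 3 * (2 * S + MS + H' - KU + K)"
        if "A2 = B2 + 6 * H + 9 * H'" "A2 + 9 * T + 9 * S + 5 = 9 * KU + 3 * U + 3 * K"
          "4 * T = 3 * MS + M + S - 1" "B2 = 3 * T + 1" for A2 B2 H H' K KU MS :: int
      proof -
        have "3 * U = 3 * (3 * MS + M + 4 * S + 1 + 2 * H + 3 * H' - 3 * KU - K)" using that by simp
        hence U: "U = 3 * MS + M + 4 * S + 1 + 2 * H + 3 * H' - 3 * KU - K" by simp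
        show ?thesis by (simp add: U)
      qed
      show ?thesis by (rule lin[OF AA norm TMS T])
    qed
    hence "[- 2 * (B * h) + (2 * S + U + 4 * int k) = M + 1] (mod 3)"
      by (simp only: cong_iff_dvd_diff dvd_triv_left)
    ultimately have "[i = M + 1] (mod 3)" by (rule cong_trans)
    moreover have "[m * n * (4 * M + 1) = M + 1] (mod 3)"
    proof -
      have "[A * s = B * s] (mod 3)" by (simp add: A cong_iff_dvd_diff algebra_simps)
      hence "[- n = - m] (mod 3)" using A_s B_s by (simp add: cong_def)
      hence "[m * n * (4 * M + 1) = m * m * (4 * M + 1)] (mod 3)"
        by (intro cong_mult) (simp_all add: cong_minus_minus_iff)
      also have "[m * m * (4 * M + 1) = M + 1] (mod 3)"
        unfolding M by (simp add: cong_iff_dvd_diff algebra_simps)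
      finally show ?thesis .
    qed
    ultimately have "[i = m * n * (4 * M + 1)] (mod 3)" by (rule cong_trans[OF _ cong_sym])
    thus ?thesis by (rule that[OF csym_\<beta>[OF i(1)]])
  next
    assume A: "A = - B + 3 * h"
    have o2: "om 2 = -1 - omega" using om_cases[of 2] by simp
    have om2: "eis_re (om 2 * \<alpha>) = 2 * B - 3 * h" "eis_om (om 2 * \<alpha>) = - 3 * h"
      by (simp_all add: \<alpha>_def A o2)
    have "primary (om 2 * \<alpha>)" unfolding primary_def om2 using B3 by presburger
    then obtain i where i: "csym \<alpha> p (om i)"
      "[i = (2 * B - 3 * h) * (- 3 * h) div 3 + 2 * (2 * S + U + 4 * int k)] (mod 3)"
      using symbol_\<alpha>[OF _ S U, of 2] unfolding om2 by metis
    have "(2 * B - 3 * h) * (- 3 * h) = 3 * (3 * (h * h) - 2 * (B * h))" by (simp add: algebra_simps)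
    also have "\<dots> div 3 = 3 * (h * h) - 2 * (B * h)" by (rule nonzero_mult_div_cancel_left) simp
    finally have "[i = 3 * (h * h) - 2 * (B * h) + 2 * (2 * S + U + 4 * int k)] (mod 3)" using i(2) by simp
    moreover
    have "3 * (h * h) - 2 * (B * h) + 2 * (2 * S + U + 4 * int k) - (- (M + 1))
        = 3 * (- 2 * (B * h) + 3 * (h * h) + 4 * S + 2 * (M * S) + M + 1 - 2 * (int k * U) + 2 * int k)"
    proof -
      have AA: "A * A = B * B - 6 * (B * h) + 9 * (h * h)" by (simp add: A algebra_simps)
      have lin: "3 * H' - 2 * H + 2 * (2 * S + U + 4 * K) - (- (M + 1))
          = 3 * (- 2 * H + 3 * H' + 4 * S + 2 * MS + M + 1 - 2 * KU + 2 * K)"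
        if "A2 = B2 - 6 * H + 9 * H'" "A2 + 9 * T + 9 * S + 5 = 9 * KU + 3 * U + 3 * K"
          "4 * T = 3 * MS + M + S - 1" "B2 = 3 * T + 1" for A2 B2 H H' K KU MS :: int
      proof -
        have "3 * U = 3 * (3 * MS + M + 4 * S + 1 - 2 * H + 3 * H' - 3 * KU - K)" using that by simp
        hence U: "U = 3 * MS + M + 4 * S + 1 - 2 * H + 3 * H' - 3 * KU - K" by simp
        show ?thesis by (simp add: U)
      qed
      show ?thesis by (rule lin[OF AA norm TMS T])
    qed
    hence "[3 * (h * h) - 2 * (B * h) + 2 * (2 * S + U + 4 * int k) = - (M + 1)] (mod 3)"
      by (simp only: cong_iff_dvd_diff dvd_triv_left)
    ultimately have "[i = - (M + 1)] (mod 3)" by (rule cong_trans)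
    moreover have "[m * n * (4 * M + 1) = - (M + 1)] (mod 3)"
    proof -
      have "[A * s = - (B * s)] (mod 3)" by (simp add: A cong_iff_dvd_diff algebra_simps)
      moreover have "[- (B * s) = - (- m)] (mod 3)" using B_s by (simp only: cong_minus_minus_iff)
      ultimately have "[- n = - (- m)] (mod 3)" using A_s by (simp add: cong_def)
      hence "[m * n * (4 * M + 1) = m * (- m) * (4 * M + 1)] (mod 3)"
        by (intro cong_mult) (simp_all only: cong_minus_minus_iff cong_refl)
      also have "m * (- m) * (4 * M + 1) = - (m * m * (4 * M + 1))" by simp
      also have "[- (m * m * (4 * M + 1)) = - (M + 1)] (mod 3)"
        unfolding M by (simp add: cong_iff_dvd_diff algebra_simps)
      finally show ?thesis .
    qed
    ultimately have "[i = m * n * (4 * M + 1)] (mod 3)" by (rule cong_trans[OF _ cong_sym])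
    thus ?thesis by (rule that[OF csym_\<beta>[OF i(1)]])
  qed
qed

end

section \<open>Case analysis of m modulo 9\<close>

theorem corollary8p3:
  fixes d m n x y :: int and p :: nat
  assumes "d > 1" and "squarefree d"
    and "m \<noteq> 0" and "n \<noteq> 0" and "m^2 - d * n^2 = -4"
    and "prime p" and "\<not> int p dvd n"
    and "int p = x^2 + 3 * d * y^2" and "\<not> 3 dvd y" and "[x = y] (mod 3)"
  shows
    "([m = 0] (mod 9) \<or> [m = 4] (mod 9) \<or> [m = -4] (mod 9) \<longrightarrow>
        [lucas_U m (-1) ((p - 1) div 3) = 0] (mod int p)) \<and>
     ([m = 3] (mod 9) \<or> [m = -3] (mod 9) \<longrightarrow>
        [lucas_U m (-1) ((p - 1) div 3)
           = Legendre (m * n div 3) 3 * (x * modular_inverse (int p) (d * n * y))] (mod int p)) \<and>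
     ([m = 1] (mod 9) \<or> [m = -1] (mod 9) \<longrightarrow>
        [lucas_U m (-1) ((p - 1) div 3)
           = - Legendre (m * n) 3 * (x * modular_inverse (int p) (d * n * y))] (mod int p)) \<and>
     ([m = 2] (mod 9) \<or> [m = -2] (mod 9) \<longrightarrow>
        [lucas_U m (-1) ((p - 1) div 3)
           = Legendre (m * n) 3 * (x * modular_inverse (int p) (d * n * y))] (mod int p))"
proof -
  define k where "k = (p - 1) div 3"
  have "3 dvd p - 1" by (rule three_dvd_p_minus_1) fact+
  hence "p = 3 * k + 1" using prime_gt_0_nat[OF \<open>prime p\<close>] by (auto simp: k_def)
  then interpret lucas_setup d m n x y p k using assms by unfold_locales auto
  let ?U = "lucas_U m (-1) k" and ?v = "x * modular_inverse (int p) (d * n * y)"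
  \<comment> \<open>The three values in \<open>lucas_U_of_symbol\<close> are the Legendre symbol of
    - i, whence the sign in the assumption on z.\<close>
  have U: "[?U = Legendre z 3 * ?v] (mod int p)"
    if "csym \<beta> p (om i)" "[i = - z] (mod 3)" for i z
  proof -
    have "(if i mod 3 = 0 then 0 else if i mod 3 = 1 then -1 else 1) = Legendre z 3"
    proof -
      have "i mod 3 = (- z) mod 3" using that(2) by (simp add: cong_def)
      hence "i mod 3 = 0 \<and> z mod 3 = 0 \<or> i mod 3 = 1 \<and> z mod 3 = 2 \<or> i mod 3 = 2 \<and> z mod 3 = 1"
        by presburger
      thus ?thesis by (auto simp: Legendre_3)
    qed
    thus ?thesis using lucas_U_of_symbol[OF that(1)] by (simp only:)
  qed
  have dvd: "[?U = Legendre (m' * n) 3 * ?v] (mod int p)" if "m = 3 * m'" for m'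
    using symbol_\<beta>_dvd_3[OF that] U by metis
  have ndvd: "[?U = Legendre z 3 * ?v] (mod int p)"
    if "m * m = 3 * M + 1" "[m * n * (4 * M + 1) = - z] (mod 3)" for M z
    using symbol_\<beta>_not_dvd_3[OF that(1)] U that(2) cong_trans by metis
  have rep: "\<exists>t. m = 9 * t + c" if "[m = c] (mod 9)" for c
    using that unfolding cong_iff_dvd_diff by (auto elim!: dvdE) (metis diff_add_cancel)
  \<comment> \<open>The resulting M is congruent to C modulo 3, so the representative c of m modulo
    9 decides the exponent.\<close>
  have sq: "m * m = 3 * (27 * (t * t) + 6 * (t * c) + C) + 1" if "m = 9 * t + c" "c * c = 3 * C + 1" for t c C
    using that(2) by (simp add: that(1) algebra_simps)
  have neg: "Legendre (- z) 3 = - Legendre z 3" for z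
  proof -
    have "z mod 3 = 0 \<and> (- z) mod 3 = 0 \<or> z mod 3 = 1 \<and> (- z) mod 3 = 2 \<or> z mod 3 = 2 \<and> (- z) mod 3 = 1"
      by presburger
    thus ?thesis by (auto simp: Legendre_3)
  qed
  have unit: "[?U = Legendre z 3 * ?v] (mod int p)"
    if c: "[m = c] (mod 9)" "c * c = 3 * C + 1" and z: "[m * n * (4 * C + 1) = - z] (mod 3)" for c C z
  proof -
    obtain t where t: "m = 9 * t + c" using rep c(1) by blast
    have "[m * n * (4 * (27 * (t * t) + 6 * (t * c) + C) + 1) = m * n * (4 * C + 1)] (mod 3)"
      by (intro cong_mult cong_refl) (simp add: cong_iff_dvd_diff algebra_simps)
    thus ?thesis using ndvd[OF sq[OF t c(2)]] z cong_trans by blast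
  qed
  show ?thesis
    unfolding k_def [symmetric]
  proof (intro conjI impI)
    assume "[m = 0] (mod 9) \<or> [m = 4] (mod 9) \<or> [m = -4] (mod 9)"
    hence "[?U = Legendre 0 3 * ?v] (mod int p)"
    proof (elim disjE)
      assume "[m = 0] (mod 9)"
      then obtain t where "m = 3 * (3 * t)" using rep[of 0] by auto
      from dvd[OF this] show ?thesis by (simp add: Legendre_3)
    next
      assume "[m = 4] (mod 9)"
      \<comment> \<open>From 16 = 3 * 5 + 1 the factor 4 C + 1 is 21, a multiple of 3; the symbol is
        trivial and z = 0.\<close>
      thus ?thesis by (rule unit[where C = 5]) (auto simp: cong_iff_dvd_diff)
    next
      assume "[m = -4] (mod 9)"
      thus ?thesis by (rule unit[where C = 5]) (auto simp: cong_iff_dvd_diff)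
    qed
    thus "[?U = 0] (mod int p)" by (simp add: Legendre_3)
  next
    assume "[m = 3] (mod 9) \<or> [m = -3] (mod 9)"
    hence "3 dvd m" by (auto dest!: rep)
    then obtain m' where m': "m = 3 * m'" by (elim dvdE)
    from dvd[OF this] show "[?U = Legendre (m * n div 3) 3 * ?v] (mod int p)" by (simp add: m')
  next
    assume "[m = 1] (mod 9) \<or> [m = -1] (mod 9)"
    \<comment> \<open>C = 0 gives the factor 1 and z = - m n. In the last case C = 1 gives 5, which
      is -1 modulo 3, and z = m n.\<close>
    thus "[?U = - Legendre (m * n) 3 * ?v] (mod int p)"
      unfolding neg[symmetric] by (elim disjE; intro unit[where C = 0]) auto
  next
    assume "[m = 2] (mod 9) \<or> [m = -2] (mod 9)"
    moreover have "[m * n * (4 * 1 + 1) = - (m * n)] (mod 3)" by (simp add: cong_iff_dvd_diff)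
    ultimately show "[?U = Legendre (m * n) 3 * ?v] (mod int p)"
      by (elim disjE; intro unit[where C = 1]) auto
  qed
qed

end
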